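(* The following assignments define a functor $\mathcal{F}$ from the category $\mathbf{ELeib}$ of enhanced Leibniz algebras to the category of (semi-strict) Lie 2-algebras. On objects: an enhanced Leibniz algebra $(t\colon\mathbb{W}\to\mathbb{V},[\cdot,\cdot],\circ)$ is sent to the Lie 2-algebra defined over the same complex, i.e. $V_1=\mathbb{W}$, $V_0=\mathbb{V}$ with the same map $t$, and with, for all $v,v_1,v_2,v_3\in\mathbb{V}$ and $w\in\mathbb{W}$, $$\{v_1,v_2\}:=[v_1,v_2]-t(v_1\circ v_2),\qquad \{v,w\}=-\{w,v\}:=v\ast w:=t(w)\circ v,$$ $$l_3(v_1,v_2,v_3):=-v_1\circ[v_2,v_3]+[v_1,v_2]\circ v_3+v_2\circ[v_1,v_3]-t(v_2\circ v_3)\circ v_1-t(v_1\circ v_2)\circ v_3+t(v_1\circ v_3)\circ v_2.$$ On morphisms: the plain morphisms and the $\beta$-transformations of enhanced Leibniz algebras are sent to the plain morphisms and the $\beta$-transformations, respectively, of the corresponding Lie 2-algebras (with the same linear maps, respectively the same $\beta$).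
   Context: All vector spaces are over a field $\mathbb{K}$ of characteristic different from $2$. A (left) Leibniz algebra $(\mathbb{V},[\cdot,\cdot])$ is a vector space with a bilinear bracket satisfying $[v_1,[v_2,v_3]]=[[v_1,v_2],v_3]+[v_2,[v_1,v_3]]$. An enhanced Leibniz algebra (ELA) $(t\colon\mathbb{W}\to\mathbb{V},[\cdot,\cdot],\circ)$ consists of a left Leibniz algebra $(\mathbb{V},[\cdot,\cdot])$, a vector space $\mathbb{W}$, a linear map $t\colon\mathbb{W}\to\mathbb{V}$, and a bilinear product $\circ\colon\mathbb{V}\times\mathbb{V}\to\mathbb{W}$ such that for all $u,v\in\mathbb{V}$, $w\in\mathbb{W}$: (a) $[t(w),v]=0$; (b) $t(w)\circ t(w)=0$; (c) $u\stackrel{s}{\circ}[v,v]=v\stackrel{s}{\circ}[u,v]$; (d) $[v,v]=t(v\circ v)$; here $u\stackrel{s}{\circ}v:=\tfrac12(u\circ v+v\circ u)$. The morphisms of $\mathbf{ELeib}$ are generated by the following two types. A plain morphism $(\varphi,\psi)$ from $(t\colon\mathbb{W}\to\mathbb{V},[\cdot,\cdot],\circ)$ to $(t'\colon\mathbb{W}'\to\mathbb{V}',[\cdot,\cdot]',\circ')$ is a pair of linear maps $\varphi\colon\mathbb{W}\to\mathbb{W}'$, $\psi\colon\mathbb{V}\to\mathbb{V}'$ such that the composite of $t$ followed by $\psi$ equals the composite of $\varphi$ followed by $t'$, $\psi$ is a morphism of Leibniz algebras, and $\psi(v_1)\circ'\psi(v_2)=\varphi(v_1\circ v_2)$ for all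 $v_1,v_2\in\mathbb{V}$. For every $\beta\in\Lambda^2\mathbb{V}^*\otimes\mathbb{W}$ (an alternating bilinear map $\mathbb{V}\times\mathbb{V}\to\mathbb{W}$), the $\beta$-transformation is $(t,[\cdot,\cdot],\circ)\mapsto(t,[\cdot,\cdot],\circ+\beta(\cdot,\cdot))$. A (semi-strict) Lie 2-algebra, equivalently a 2-term $L_\infty$-algebra, is a linear map $t\colon V_1\to V_0$ with a bilinear bracket $l_2=\{\cdot,\cdot\}\colon V_i\times V_j\to V_{i+j}$ for $0\le i+j\le1$ and a trilinear map $l_3\colon V_0\times V_0\times V_0\to V_1$ such that for all $w,x,y,z\in V_0$, $h,k\in V_1$: (a) $\{x,y\}=-\{y,x\}$; (b) $\{x,h\}=-\{h,x\}$; (c) $\{h,k\}=0$; (d) $l_3(x,y,z)$ is totally antisymmetric; (e) $t(\{x,h\})=\{x,t(h)\}$; (f) $\{t(h),k\}=\{h,t(k)\}$; (g) $t(l_3(x,y,z))=-\{\{x,y\},z\}+\{\{x,z\},y\}+\{x,\{y,z\}\}$; (h) $l_3(t(h),x,y)=-\{\{x,y\},h\}+\{\{x,h\},y\}+\{x,\{y,h\}\}$; (i) $\{l_3(w,x,y),z\}+\{l_3(w,y,z),x\}-\{l_3(w,x,z),y\}-\{l_3(x,y,z),w\}+l_3(\{x,z\},w,y)+l_3(\{w,y\},x,z)-l_3(\{w,x\},y,z)-l_3(\{w,z\},x,y)-l_3(\{x,y\},w,z)-l_3(\{y,z\},w,x)=0$. The morphisms of Lie 2-algebras considered are of two types (and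 what they generate). A plain morphism is a pair of linear maps $V_1\to V_1'$, $V_0\to V_0'$ which commutes with $t,t'$ and preserves the brackets $l_2$ and $l_3$. Every $\beta\in\Lambda^2V_0^*\otimes V_1$ gives rise to a $\beta$-transformation, which leaves $t$ unchanged and maps, with $v\ast w:=\{v,w\}$ for $v\in V_0$, $w\in V_1$: $\{v_1,v_2\}\mapsto\{v_1,v_2\}-t(\beta(v_1,v_2))$; $\{v,w\}\mapsto\{v,w\}+\beta(t(w),v)$; $l_3(v_1,v_2,v_3)\mapsto l_3(v_1,v_2,v_3)-\bar D\beta(v_1,v_2,v_3)-\sum_{\mathrm{cycl}(1,2,3)}\beta(t(\beta(v_1,v_2)),v_3)$, where $\bar D\beta(v_1,v_2,v_3)=v_1\ast\beta(v_2,v_3)-v_2\ast\beta(v_1,v_3)+v_3\ast\beta(v_1,v_2)-\beta(\{v_1,v_2\},v_3)+\beta(\{v_1,v_3\},v_2)-\beta(\{v_2,v_3\},v_1)$. *)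

theory Defs
  imports "HOL-Algebra.Module" "HOL-Library.FuncSet"
begin

section \<open>Multilinear maps\<close>

text \<open>
  Vector spaces are modules over a field in the sense of HOL-Algebra. All maps are extensional
  (undefined outside the carriers), so that equality in HOL is equality of maps on the carriers.
\<close>

definition linear_maps ::
  "('k, 'm) ring_scheme \<Rightarrow> ('k, 'a) module \<Rightarrow> ('k, 'b) module \<Rightarrow> ('a \<Rightarrow> 'b) set" where
  "linear_maps K M N = {f \<in> carrier M \<rightarrow>\<^sub>E carrier N.
     (\<forall>x \<in> carrier M. \<forall>y \<in> carrier M. f (x \<oplus>\<^bsub>M\<^esub> y) = f x \<oplus>\<^bsub>N\<^esub> f y) \<and>
     (\<forall>a \<in> carrier K. \<forall>x \<in> carrier M. f (a \<odot>\<^bsub>M\<^esub> x) = a \<odot>\<^bsub>N\<^esub> f x)}"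

definition bilinear_maps ::
  "('k, 'm) ring_scheme \<Rightarrow> ('k, 'a) module \<Rightarrow> ('k, 'b) module \<Rightarrow> ('k, 'c) module
    \<Rightarrow> ('a \<Rightarrow> 'b \<Rightarrow> 'c) set" where
  "bilinear_maps K L M N = {f \<in> carrier L \<rightarrow>\<^sub>E carrier M \<rightarrow>\<^sub>E carrier N.
     (\<forall>x \<in> carrier L. f x \<in> linear_maps K M N) \<and>
     (\<forall>y \<in> carrier M. (\<lambda>x \<in> carrier L. f x y) \<in> linear_maps K L N)}"

definition trilinear_maps ::
  "('k, 'm) ring_scheme \<Rightarrow> ('k, 'a) module \<Rightarrow> ('k, 'b) module \<Rightarrow> ('k, 'c) module \<Rightarrow> ('k, 'd) module
    \<Rightarrow> ('a \<Rightarrow> 'b \<Rightarrow> 'c \<Rightarrow> 'd) set" where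
  "trilinear_maps K L M N P = {f \<in> carrier L \<rightarrow>\<^sub>E carrier M \<rightarrow>\<^sub>E carrier N \<rightarrow>\<^sub>E carrier P.
     (\<forall>x \<in> carrier L. f x \<in> bilinear_maps K M N P) \<and>
     (\<forall>y \<in> carrier M. \<forall>z \<in> carrier N. (\<lambda>x \<in> carrier L. f x y z) \<in> linear_maps K L P)}"

definition alternating_maps ::
  "('k, 'm) ring_scheme \<Rightarrow> ('k, 'v) module \<Rightarrow> ('k, 'w) module \<Rightarrow> ('v \<Rightarrow> 'v \<Rightarrow> 'w) set" where
  "alternating_maps K V W =
     {\<beta> \<in> bilinear_maps K V V W. \<forall>v \<in> carrier V. \<beta> v v = \<zero>\<^bsub>W\<^esub>}"


section \<open>Enhanced Leibniz algebras and Lie 2-algebras\<close>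

locale leibniz_algebra =
  fixes K :: "('k, 'm) ring_scheme" and V :: "('k, 'v) module"
    and br :: "'v \<Rightarrow> 'v \<Rightarrow> 'v"
  assumes field_K: "field K"
    and module_V: "module K V"
    and br_bilinear: "br \<in> bilinear_maps K V V V"
    and leibniz: "\<lbrakk>u \<in> carrier V; v \<in> carrier V; w \<in> carrier V\<rbrakk>
      \<Longrightarrow> br u (br v w) = br (br u v) w \<oplus>\<^bsub>V\<^esub> br v (br u w)"

definition half_sym ::
  "('k, 'm) ring_scheme \<Rightarrow> ('k, 'w) module \<Rightarrow> ('v \<Rightarrow> 'v \<Rightarrow> 'w) \<Rightarrow> 'v \<Rightarrow> 'v \<Rightarrow> 'w" where
  "half_sym K W f u v = inv\<^bsub>K\<^esub> (\<one>\<^bsub>K\<^esub> \<oplus>\<^bsub>K\<^esub> \<one>\<^bsub>K\<^esub>) \<odot>\<^bsub>W\<^esub> (f u v \<oplus>\<^bsub>W\<^esub> f v u)"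

locale enhanced_leibniz_algebra = leibniz_algebra K V br
  for K :: "('k, 'm) ring_scheme" and V :: "('k, 'v) module" and br +
  fixes W :: "('k, 'w) module" and t :: "'w \<Rightarrow> 'v"
    and crc :: "'v \<Rightarrow> 'v \<Rightarrow> 'w"
  assumes module_W: "module K W"
    and t_linear: "t \<in> linear_maps K W V"
    and crc_bilinear: "crc \<in> bilinear_maps K V V W"
    and br_t: "\<lbrakk>w \<in> carrier W; v \<in> carrier V\<rbrakk> \<Longrightarrow> br (t w) v = \<zero>\<^bsub>V\<^esub>"
    and crc_t_t: "w \<in> carrier W \<Longrightarrow> crc (t w) (t w) = \<zero>\<^bsub>W\<^esub>"
    and sym_br: "\<lbrakk>u \<in> carrier V; v \<in> carrier V\<rbrakk>
      \<Longrightarrow> half_sym K W crc u (br v v) = half_sym K W crc v (br u v)"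
    and br_square: "v \<in> carrier V \<Longrightarrow> br v v = t (crc v v)"

text \<open>
  The graded bracket of a Lie 2-algebra is given by its components \<open>b00\<close> on \<open>V0 \<times> V0\<close>, \<open>b01\<close> on
  \<open>V0 \<times> V1\<close> and \<open>b10\<close> on \<open>V1 \<times> V0\<close>. The component on \<open>V1 \<times> V1\<close> has degree 2, hence is zero,
  and is not represented.
\<close>

locale lie_2_algebra =
  fixes K :: "('k, 'm) ring_scheme"
    and V0 :: "('k, 'v) module" and V1 :: "('k, 'w) module" and t :: "'w \<Rightarrow> 'v"
    and b00 :: "'v \<Rightarrow> 'v \<Rightarrow> 'v" and b01 :: "'v \<Rightarrow> 'w \<Rightarrow> 'w" and b10 :: "'w \<Rightarrow> 'v \<Rightarrow> 'w"
    and l3 :: "'v \<Rightarrow> 'v \<Rightarrow> 'v \<Rightarrow> 'w"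
  assumes field_K: "field K"
    and module_V0: "module K V0"
    and module_V1: "module K V1"
    and t_linear: "t \<in> linear_maps K V1 V0"
    and b00_bilinear: "b00 \<in> bilinear_maps K V0 V0 V0"
    and b01_bilinear: "b01 \<in> bilinear_maps K V0 V1 V1"
    and b10_bilinear: "b10 \<in> bilinear_maps K V1 V0 V1"
    and l3_trilinear: "l3 \<in> trilinear_maps K V0 V0 V0 V1"
    and b00_antisym: "\<lbrakk>x \<in> carrier V0; y \<in> carrier V0\<rbrakk> \<Longrightarrow> b00 x y = \<ominus>\<^bsub>V0\<^esub> b00 y x"
    and b01_b10: "\<lbrakk>x \<in> carrier V0; h \<in> carrier V1\<rbrakk> \<Longrightarrow> b01 x h = \<ominus>\<^bsub>V1\<^esub> b10 h x"
    and l3_antisym: "\<lbrakk>x \<in> carrier V0; y \<in> carrier V0; z \<in> carrier V0\<rbrakk>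
      \<Longrightarrow> l3 x y z = \<ominus>\<^bsub>V1\<^esub> l3 y x z \<and> l3 x y z = \<ominus>\<^bsub>V1\<^esub> l3 x z y \<and> l3 x y z = \<ominus>\<^bsub>V1\<^esub> l3 z y x"
    and t_b01: "\<lbrakk>x \<in> carrier V0; h \<in> carrier V1\<rbrakk> \<Longrightarrow> t (b01 x h) = b00 x (t h)"
    and peiffer: "\<lbrakk>h \<in> carrier V1; k \<in> carrier V1\<rbrakk> \<Longrightarrow> b01 (t h) k = b10 h (t k)"
    and t_l3: "\<lbrakk>x \<in> carrier V0; y \<in> carrier V0; z \<in> carrier V0\<rbrakk>
      \<Longrightarrow> t (l3 x y z) =
          \<ominus>\<^bsub>V0\<^esub> b00 (b00 x y) z \<oplus>\<^bsub>V0\<^esub> b00 (b00 x z) y \<oplus>\<^bsub>V0\<^esub> b00 x (b00 y z)"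
    and l3_t: "\<lbrakk>h \<in> carrier V1; x \<in> carrier V0; y \<in> carrier V0\<rbrakk>
      \<Longrightarrow> l3 (t h) x y =
          \<ominus>\<^bsub>V1\<^esub> b01 (b00 x y) h \<oplus>\<^bsub>V1\<^esub> b10 (b01 x h) y \<oplus>\<^bsub>V1\<^esub> b01 x (b01 y h)"
    and jacobiator: "\<lbrakk>w \<in> carrier V0; x \<in> carrier V0; y \<in> carrier V0; z \<in> carrier V0\<rbrakk>
      \<Longrightarrow> b10 (l3 w x y) z \<oplus>\<^bsub>V1\<^esub> b10 (l3 w y z) x
          \<ominus>\<^bsub>V1\<^esub> b10 (l3 w x z) y \<ominus>\<^bsub>V1\<^esub> b10 (l3 x y z) w
          \<oplus>\<^bsub>V1\<^esub> l3 (b00 x z) w y \<oplus>\<^bsub>V1\<^esub> l3 (b00 w y) x z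
          \<ominus>\<^bsub>V1\<^esub> l3 (b00 w x) y z \<ominus>\<^bsub>V1\<^esub> l3 (b00 w z) x y
          \<ominus>\<^bsub>V1\<^esub> l3 (b00 x y) w z \<ominus>\<^bsub>V1\<^esub> l3 (b00 y z) w x = \<zero>\<^bsub>V1\<^esub>"

text \<open>For an enhanced Leibniz algebra, \<open>sp1\<close> is the space W and \<open>sp0\<close> is the space V.\<close>

record ('k, 'v, 'w) two_term =
  sp0 :: "('k, 'v) module"
  sp1 :: "('k, 'w) module"
  tmap :: "'w \<Rightarrow> 'v"

record ('k, 'v, 'w) ela = "('k, 'v, 'w) two_term" +
  lbr :: "'v \<Rightarrow> 'v \<Rightarrow> 'v"
  circ :: "'v \<Rightarrow> 'v \<Rightarrow> 'w"

record ('k, 'v, 'w) lie2 = "('k, 'v, 'w) two_term" +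
  br00 :: "'v \<Rightarrow> 'v \<Rightarrow> 'v"
  br01 :: "'v \<Rightarrow> 'w \<Rightarrow> 'w"
  br10 :: "'w \<Rightarrow> 'v \<Rightarrow> 'w"
  jac :: "'v \<Rightarrow> 'v \<Rightarrow> 'v \<Rightarrow> 'w"

definition elas :: "('k, 'm) ring_scheme \<Rightarrow> ('k, 'v, 'w) ela set" where
  "elas K = {A. enhanced_leibniz_algebra K (sp0 A) (lbr A) (sp1 A) (tmap A) (circ A)}"

definition lie2s :: "('k, 'm) ring_scheme \<Rightarrow> ('k, 'v, 'w) lie2 set" where
  "lie2s K =
     {L. lie_2_algebra K (sp0 L) (sp1 L) (tmap L) (br00 L) (br01 L) (br10 L) (jac L)}"


section \<open>Categories and functors\<close>

record ('o, 'a) cat =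
  Obj :: "'o set"
  Arr :: "'a set"
  Dom :: "'a \<Rightarrow> 'o"
  Cod :: "'a \<Rightarrow> 'o"
  Ident :: "'o \<Rightarrow> 'a"
  Comp :: "'a \<Rightarrow> 'a \<Rightarrow> 'a"  \<comment> \<open>\<open>Comp C g f\<close> is \<open>f\<close> followed by \<open>g\<close>\<close>

locale category =
  fixes C :: "('o, 'a) cat"
  assumes Dom_Obj: "f \<in> Arr C \<Longrightarrow> Dom C f \<in> Obj C"
    and Cod_Obj: "f \<in> Arr C \<Longrightarrow> Cod C f \<in> Obj C"
    and Ident_Arr: "x \<in> Obj C \<Longrightarrow> Ident C x \<in> Arr C"
    and Dom_Ident: "x \<in> Obj C \<Longrightarrow> Dom C (Ident C x) = x"
    and Cod_Ident: "x \<in> Obj C \<Longrightarrow> Cod C (Ident C x) = x"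
    and Comp_Arr: "\<lbrakk>f \<in> Arr C; g \<in> Arr C; Cod C f = Dom C g\<rbrakk> \<Longrightarrow> Comp C g f \<in> Arr C"
    and Dom_Comp: "\<lbrakk>f \<in> Arr C; g \<in> Arr C; Cod C f = Dom C g\<rbrakk> \<Longrightarrow> Dom C (Comp C g f) = Dom C f"
    and Cod_Comp: "\<lbrakk>f \<in> Arr C; g \<in> Arr C; Cod C f = Dom C g\<rbrakk> \<Longrightarrow> Cod C (Comp C g f) = Cod C g"
    and Comp_Ident_right: "f \<in> Arr C \<Longrightarrow> Comp C f (Ident C (Dom C f)) = f"
    and Comp_Ident_left: "f \<in> Arr C \<Longrightarrow> Comp C (Ident C (Cod C f)) f = f"
    and Comp_assoc: "\<lbrakk>f \<in> Arr C; g \<in> Arr C; h \<in> Arr C; Cod C f = Dom C g; Cod C g = Dom C h\<rbrakk>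
      \<Longrightarrow> Comp C h (Comp C g f) = Comp C (Comp C h g) f"

locale cat_functor = C: category C + D: category D
  for C :: "('o, 'a) cat" and D :: "('p, 'b) cat" +
  fixes FO :: "'o \<Rightarrow> 'p" and FA :: "'a \<Rightarrow> 'b"
  assumes FO_Obj: "x \<in> Obj C \<Longrightarrow> FO x \<in> Obj D"
    and FA_Arr: "f \<in> Arr C \<Longrightarrow> FA f \<in> Arr D"
    and Dom_FA: "f \<in> Arr C \<Longrightarrow> Dom D (FA f) = FO (Dom C f)"
    and Cod_FA: "f \<in> Arr C \<Longrightarrow> Cod D (FA f) = FO (Cod C f)"
    and FA_Ident: "x \<in> Obj C \<Longrightarrow> FA (Ident C x) = Ident D (FO x)"
    and FA_Comp: "\<lbrakk>f \<in> Arr C; g \<in> Arr C; Cod C f = Dom C g\<rbrakk>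
      \<Longrightarrow> FA (Comp C g f) = Comp D (FA g) (FA f)"


section \<open>Arrows\<close>

text \<open>
  An arrow carries its source and target, the two linear maps, and an alternating map from pairs in
  degree 0 of the source to degree 1 of the target. The last component is 0 for plain morphisms and
  \<open>\<beta>\<close> for \<open>\<beta>\<close>-transformations; it has to be recorded because different \<open>\<beta>\<close> may relate the same two
  Lie 2-algebras. Composition is that of morphisms of 2-term L-infinity algebras. In particular,
  \<open>\<beta>\<close>-transformations compose by adding the \<open>\<beta>\<close>s, as they do when applied to the structures.
\<close>

record ('o, 'v, 'w) arrow =
  src :: 'o
  tgt :: 'o
  map1 :: "'w \<Rightarrow> 'w"
  map0 :: "'v \<Rightarrow> 'v"
  hty :: "'v \<Rightarrow> 'v \<Rightarrow> 'w"

definition plain_arrow ::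
  "('k, 'v, 'w, 'x) two_term_scheme \<Rightarrow> ('k, 'v, 'w, 'x) two_term_scheme \<Rightarrow> ('w \<Rightarrow> 'w) \<Rightarrow> ('v \<Rightarrow> 'v)
    \<Rightarrow> (('k, 'v, 'w, 'x) two_term_scheme, 'v, 'w) arrow" where
  "plain_arrow A B \<phi> \<psi> =
     \<lparr>src = A, tgt = B, map1 = \<phi>, map0 = \<psi>,
      hty = (\<lambda>u \<in> carrier (sp0 A). \<lambda>v \<in> carrier (sp0 A). \<zero>\<^bsub>sp1 B\<^esub>)\<rparr>"

definition beta_arrow ::
  "('k, 'v, 'w, 'x) two_term_scheme \<Rightarrow> ('k, 'v, 'w, 'x) two_term_scheme \<Rightarrow> ('v \<Rightarrow> 'v \<Rightarrow> 'w)
    \<Rightarrow> (('k, 'v, 'w, 'x) two_term_scheme, 'v, 'w) arrow" where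
  "beta_arrow A B \<beta> =
     \<lparr>src = A, tgt = B, map1 = (\<lambda>w \<in> carrier (sp1 A). w), map0 = (\<lambda>v \<in> carrier (sp0 A). v),
      hty = \<beta>\<rparr>"

definition id_arrow ::
  "('k, 'v, 'w, 'x) two_term_scheme \<Rightarrow> (('k, 'v, 'w, 'x) two_term_scheme, 'v, 'w) arrow" where
  "id_arrow A = plain_arrow A A (\<lambda>w \<in> carrier (sp1 A). w) (\<lambda>v \<in> carrier (sp0 A). v)"

definition comp_arrow ::
  "(('k, 'v, 'w, 'x) two_term_scheme, 'v, 'w) arrow
    \<Rightarrow> (('k, 'v, 'w, 'x) two_term_scheme, 'v, 'w) arrow
    \<Rightarrow> (('k, 'v, 'w, 'x) two_term_scheme, 'v, 'w) arrow" where
  "comp_arrow g f =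
     \<lparr>src = src f, tgt = tgt g,
      map1 = compose (carrier (sp1 (src f))) (map1 g) (map1 f),
      map0 = compose (carrier (sp0 (src f))) (map0 g) (map0 f),
      hty = (\<lambda>u \<in> carrier (sp0 (src f)). \<lambda>v \<in> carrier (sp0 (src f)).
        map1 g (hty f u v) \<oplus>\<^bsub>sp1 (tgt g)\<^esub> hty g (map0 f u) (map0 f v))\<rparr>"

inductive_set generated ::
  "(('k, 'v, 'w, 'x) two_term_scheme, 'v, 'w) arrow set
    \<Rightarrow> (('k, 'v, 'w, 'x) two_term_scheme, 'v, 'w) arrow set"
  for S where
  generator: "f \<in> S \<Longrightarrow> f \<in> generated S"
| comp: "\<lbrakk>f \<in> generated S; g \<in> generated S; tgt f = src g\<rbrakk> \<Longrightarrow> comp_arrow g f \<in> generated S"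


section \<open>The category of enhanced Leibniz algebras\<close>

definition ela_plain_arrows ::
  "('k, 'm) ring_scheme \<Rightarrow> (('k, 'v, 'w) ela, 'v, 'w) arrow set" where
  "ela_plain_arrows K = {plain_arrow A B \<phi> \<psi> | A B \<phi> \<psi>.
     A \<in> elas K \<and> B \<in> elas K \<and>
     \<phi> \<in> linear_maps K (sp1 A) (sp1 B) \<and> \<psi> \<in> linear_maps K (sp0 A) (sp0 B) \<and>
     (\<forall>w \<in> carrier (sp1 A). \<psi> (tmap A w) = tmap B (\<phi> w)) \<and>
     (\<forall>u \<in> carrier (sp0 A). \<forall>v \<in> carrier (sp0 A). \<psi> (lbr A u v) = lbr B (\<psi> u) (\<psi> v)) \<and>
     (\<forall>u \<in> carrier (sp0 A). \<forall>v \<in> carrier (sp0 A). circ B (\<psi> u) (\<psi> v) = \<phi> (circ A u v))}"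

definition ela_beta :: "('k, 'v, 'w) ela \<Rightarrow> ('v \<Rightarrow> 'v \<Rightarrow> 'w) \<Rightarrow> ('k, 'v, 'w) ela" where
  "ela_beta A \<beta> = A\<lparr>circ := (\<lambda>u \<in> carrier (sp0 A). \<lambda>v \<in> carrier (sp0 A).
     circ A u v \<oplus>\<^bsub>sp1 A\<^esub> \<beta> u v)\<rparr>"

definition ela_beta_arrows ::
  "('k, 'm) ring_scheme \<Rightarrow> (('k, 'v, 'w) ela, 'v, 'w) arrow set" where
  "ela_beta_arrows K = {beta_arrow A (ela_beta A \<beta>) \<beta> | A \<beta>.
     A \<in> elas K \<and> \<beta> \<in> alternating_maps K (sp0 A) (sp1 A) \<and> ela_beta A \<beta> \<in> elas K}"

definition ELeib ::
  "('k, 'm) ring_scheme \<Rightarrow> (('k, 'v, 'w) ela, (('k, 'v, 'w) ela, 'v, 'w) arrow) cat" where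
  "ELeib K = \<lparr>Obj = elas K, Arr = generated (ela_plain_arrows K \<union> ela_beta_arrows K),
     Dom = src, Cod = tgt, Ident = id_arrow, Comp = comp_arrow\<rparr>"


section \<open>The category of Lie 2-algebras\<close>

definition lie2_plain_arrows ::
  "('k, 'm) ring_scheme \<Rightarrow> (('k, 'v, 'w) lie2, 'v, 'w) arrow set" where
  "lie2_plain_arrows K = {plain_arrow L M \<phi> \<psi> | L M \<phi> \<psi>.
     L \<in> lie2s K \<and> M \<in> lie2s K \<and>
     \<phi> \<in> linear_maps K (sp1 L) (sp1 M) \<and> \<psi> \<in> linear_maps K (sp0 L) (sp0 M) \<and>
     (\<forall>h \<in> carrier (sp1 L). \<psi> (tmap L h) = tmap M (\<phi> h)) \<and>
     (\<forall>x \<in> carrier (sp0 L). \<forall>y \<in> carrier (sp0 L). \<psi> (br00 L x y) = br00 M (\<psi> x) (\<psi> y)) \<and>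
     (\<forall>x \<in> carrier (sp0 L). \<forall>h \<in> carrier (sp1 L). \<phi> (br01 L x h) = br01 M (\<psi> x) (\<phi> h)) \<and>
     (\<forall>h \<in> carrier (sp1 L). \<forall>x \<in> carrier (sp0 L). \<phi> (br10 L h x) = br10 M (\<phi> h) (\<psi> x)) \<and>
     (\<forall>x \<in> carrier (sp0 L). \<forall>y \<in> carrier (sp0 L). \<forall>z \<in> carrier (sp0 L).
        \<phi> (jac L x y z) = jac M (\<psi> x) (\<psi> y) (\<psi> z))}"

definition Dbar :: "('k, 'v, 'w) lie2 \<Rightarrow> ('v \<Rightarrow> 'v \<Rightarrow> 'w) \<Rightarrow> 'v \<Rightarrow> 'v \<Rightarrow> 'v \<Rightarrow> 'w" where
  "Dbar L \<beta> x y z =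
     br01 L x (\<beta> y z) \<ominus>\<^bsub>sp1 L\<^esub> br01 L y (\<beta> x z) \<oplus>\<^bsub>sp1 L\<^esub> br01 L z (\<beta> x y)
     \<ominus>\<^bsub>sp1 L\<^esub> \<beta> (br00 L x y) z \<oplus>\<^bsub>sp1 L\<^esub> \<beta> (br00 L x z) y \<ominus>\<^bsub>sp1 L\<^esub> \<beta> (br00 L y z) x"

text \<open>The transformation of \<open>br10\<close> is forced by that of \<open>br01\<close> through antisymmetry.\<close>

definition lie2_beta :: "('k, 'v, 'w) lie2 \<Rightarrow> ('v \<Rightarrow> 'v \<Rightarrow> 'w) \<Rightarrow> ('k, 'v, 'w) lie2" where
  "lie2_beta L \<beta> = L\<lparr>
     br00 := (\<lambda>x \<in> carrier (sp0 L). \<lambda>y \<in> carrier (sp0 L).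
       br00 L x y \<ominus>\<^bsub>sp0 L\<^esub> tmap L (\<beta> x y)),
     br01 := (\<lambda>x \<in> carrier (sp0 L). \<lambda>h \<in> carrier (sp1 L).
       br01 L x h \<oplus>\<^bsub>sp1 L\<^esub> \<beta> (tmap L h) x),
     br10 := (\<lambda>h \<in> carrier (sp1 L). \<lambda>x \<in> carrier (sp0 L).
       br10 L h x \<ominus>\<^bsub>sp1 L\<^esub> \<beta> (tmap L h) x),
     jac := (\<lambda>x \<in> carrier (sp0 L). \<lambda>y \<in> carrier (sp0 L). \<lambda>z \<in> carrier (sp0 L).
       jac L x y z \<ominus>\<^bsub>sp1 L\<^esub> Dbar L \<beta> x y z
       \<ominus>\<^bsub>sp1 L\<^esub> (\<beta> (tmap L (\<beta> x y)) z \<oplus>\<^bsub>sp1 L\<^esub> \<beta> (tmap L (\<beta> y z)) x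
          \<oplus>\<^bsub>sp1 L\<^esub> \<beta> (tmap L (\<beta> z x)) y))\<rparr>"

definition lie2_beta_arrows ::
  "('k, 'm) ring_scheme \<Rightarrow> (('k, 'v, 'w) lie2, 'v, 'w) arrow set" where
  "lie2_beta_arrows K = {beta_arrow L (lie2_beta L \<beta>) \<beta> | L \<beta>.
     L \<in> lie2s K \<and> \<beta> \<in> alternating_maps K (sp0 L) (sp1 L) \<and> lie2_beta L \<beta> \<in> lie2s K}"

definition Lie2Alg ::
  "('k, 'm) ring_scheme \<Rightarrow> (('k, 'v, 'w) lie2, (('k, 'v, 'w) lie2, 'v, 'w) arrow) cat" where
  "Lie2Alg K = \<lparr>Obj = lie2s K, Arr = generated (lie2_plain_arrows K \<union> lie2_beta_arrows K),
     Dom = src, Cod = tgt, Ident = id_arrow, Comp = comp_arrow\<rparr>"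


section \<open>The assignments on objects and arrows\<close>

definition lie2_of :: "('k, 'v, 'w) ela \<Rightarrow> ('k, 'v, 'w) lie2" where
  "lie2_of A = \<lparr>sp0 = sp0 A, sp1 = sp1 A, tmap = tmap A,
     br00 = (\<lambda>v\<^sub>1 \<in> carrier (sp0 A). \<lambda>v\<^sub>2 \<in> carrier (sp0 A).
       lbr A v\<^sub>1 v\<^sub>2 \<ominus>\<^bsub>sp0 A\<^esub> tmap A (circ A v\<^sub>1 v\<^sub>2)),
     br01 = (\<lambda>v \<in> carrier (sp0 A). \<lambda>w \<in> carrier (sp1 A). circ A (tmap A w) v),
     br10 = (\<lambda>w \<in> carrier (sp1 A). \<lambda>v \<in> carrier (sp0 A). \<ominus>\<^bsub>sp1 A\<^esub> circ A (tmap A w) v),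
     jac = (\<lambda>v\<^sub>1 \<in> carrier (sp0 A). \<lambda>v\<^sub>2 \<in> carrier (sp0 A). \<lambda>v\<^sub>3 \<in> carrier (sp0 A).
       \<ominus>\<^bsub>sp1 A\<^esub> circ A v\<^sub>1 (lbr A v\<^sub>2 v\<^sub>3)
       \<oplus>\<^bsub>sp1 A\<^esub> circ A (lbr A v\<^sub>1 v\<^sub>2) v\<^sub>3
       \<oplus>\<^bsub>sp1 A\<^esub> circ A v\<^sub>2 (lbr A v\<^sub>1 v\<^sub>3)
       \<ominus>\<^bsub>sp1 A\<^esub> circ A (tmap A (circ A v\<^sub>2 v\<^sub>3)) v\<^sub>1
       \<ominus>\<^bsub>sp1 A\<^esub> circ A (tmap A (circ A v\<^sub>1 v\<^sub>2)) v\<^sub>3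
       \<oplus>\<^bsub>sp1 A\<^esub> circ A (tmap A (circ A v\<^sub>1 v\<^sub>3)) v\<^sub>2)\<rparr>"

definition lie2_of_arrow ::
  "(('k, 'v, 'w) ela, 'v, 'w) arrow \<Rightarrow> (('k, 'v, 'w) lie2, 'v, 'w) arrow" where
  "lie2_of_arrow f = \<lparr>src = lie2_of (src f), tgt = lie2_of (tgt f),
     map1 = map1 f, map0 = map0 f, hty = hty f\<rparr>"

end

theory Submission
  imports Defs "HOL-Algebra.Free_Abelian_Groups"
begin

text \<open>
  Write \<open>{x, y} = [x, y] - t(x \<circ> y)\<close> and \<open>x . h = x \<circ> t(h) + t(h) \<circ> x\<close>. The symmetry axiom (c) says that
  \<open>u . (v \<circ> w) - [u, v] \<circ> w - v \<circ> [u, w]\<close> is alternating in \<open>v, w\<close>; taking \<open>w\<close> in the image of \<open>t\<close> shows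
  that \<open>.\<close> is an action of the Leibniz algebra on \<open>W\<close>. It kills the image of \<open>t\<close>, so also
  \<open>{u, v} . h = u . (v . h) - v . (u . h)\<close>. Moreover
  \<open>l\<^sub>3(x, y, z) = {x, y} \<circ> z - x \<circ> {y, z} + y \<circ> {x, z} - x . (y \<circ> z) + y . (x \<circ> z)\<close>,
  and in these terms the Lie 2-algebra axioms become short computations. The structure obtained from
  \<open>\<circ> + \<beta>\<close> is the \<open>\<beta>\<close>-transform of the one obtained from \<open>\<circ>\<close>, which is therefore a Lie 2-algebra
  without further computation.
\<close>

section \<open>Identities in abelian groups\<close>

text \<open>
  Equations between sums in the carrier of a group are reduced to equations in the type of formal
  integer combinations, where the simplifier can cancel.
\<close>

inductive represents :: "('a, 'm) ring_scheme \<Rightarrow> ('a \<Rightarrow>\<^sub>0 int) \<Rightarrow> 'a \<Rightarrow> bool" for G where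
  add: "\<lbrakk>represents G c x; represents G d y\<rbrakk> \<Longrightarrow> represents G (c + d) (x \<oplus>\<^bsub>G\<^esub> y)"
| diff: "\<lbrakk>represents G c x; represents G d y\<rbrakk> \<Longrightarrow> represents G (c - d) (x \<ominus>\<^bsub>G\<^esub> y)"
| neg: "represents G c x \<Longrightarrow> represents G (- c) (\<ominus>\<^bsub>G\<^esub> x)"
| zero: "represents G 0 \<zero>\<^bsub>G\<^esub>"
| atom: "x \<in> carrier G \<Longrightarrow> represents G (frag_of x) x"

text \<open>Evaluating a formal combination in the group is well defined. The compound rules of
  \<open>represents\<close> precede \<open>atom\<close>, so proof search decomposes a term as far as
  possible and treats only the remaining products as generators; equality of the two combinations is
  then left to \<open>simp\<close>.\<close>

lemma (in abelian_group) represents_unique: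
  assumes "represents G c x" and "represents G d y" and "c = d"
  shows "x = y"
proof -
  note group = comm_group.axioms(2) [OF a_comm_group]
  \<comment> \<open>\<open>h\<close> is evaluation: the homomorphism from the free abelian group on
    the carrier that extends the identity map of generators.\<close>
  obtain h where h: "h \<in> hom (free_Abelian_group (carrier G)) (add_monoid G)"
    and h_frag: "\<And>x. x \<in> carrier G \<Longrightarrow> h (frag_of x) = x"
    using comm_group.free_Abelian_group_universal [OF a_comm_group, of "\<lambda>x. x" "carrier G"] by auto
  interpret h: group_hom "free_Abelian_group (carrier G)" "add_monoid G" h
    using h by (simp add: group_hom_def group_hom_axioms_def group)
  \<comment> \<open>The support condition is part of the induction because the laws of
    \<open>h\<close> hold only on combinations supported in the carrier.\<close>
  have "Poly_Mapping.keys c \<subseteq> carrier G \<and> x \<in> carrier G \<and> h c = x" if "represents G c x" for c x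
    using that
  proof induction
    case (add c x d y)
    then show ?case
      using h.hom_mult [of c d] keys_add [of c d] by auto
  next
    case (diff c x d y)
    then have "h (- d) = \<ominus> y"
      using h.hom_inv [of d] by (simp add: a_inv_def)
    with diff show ?case
      using h.hom_mult [of c "- d"] keys_diff [of c d] by (auto simp: minus_eq)
  next
    case (neg c x)
    then show ?case
      using h.hom_inv [of c] by (simp add: a_inv_def)
  next
    case zero
    then show ?case
      using h.hom_one by simp
  next
    case (atom x)
    then show ?case
      by (simp add: h_frag)
  qed
  with assms show ?thesis
    by metis
qed


section \<open>Linear maps\<close>

text \<open>Unlike \<^const>\<open>linear_maps\<close>, this does not ask for extensionality, so it is closed under term formation.\<close>

definition linear_on ::
  "('k, 'm) ring_scheme \<Rightarrow> ('k, 'a) module \<Rightarrow> ('k, 'b) module \<Rightarrow> ('a \<Rightarrow> 'b) \<Rightarrow> bool" where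
  "linear_on K M N f \<longleftrightarrow> f \<in> carrier M \<rightarrow> carrier N \<and>
     (\<forall>x \<in> carrier M. \<forall>y \<in> carrier M. f (x \<oplus>\<^bsub>M\<^esub> y) = f x \<oplus>\<^bsub>N\<^esub> f y) \<and>
     (\<forall>a \<in> carrier K. \<forall>x \<in> carrier M. f (a \<odot>\<^bsub>M\<^esub> x) = a \<odot>\<^bsub>N\<^esub> f x)"

lemma linear_onD:
  assumes "linear_on K M N f"
  shows "x \<in> carrier M \<Longrightarrow> f x \<in> carrier N"
    and "\<lbrakk>x \<in> carrier M; y \<in> carrier M\<rbrakk> \<Longrightarrow> f (x \<oplus>\<^bsub>M\<^esub> y) = f x \<oplus>\<^bsub>N\<^esub> f y"
    and "\<lbrakk>a \<in> carrier K; x \<in> carrier M\<rbrakk> \<Longrightarrow> f (a \<odot>\<^bsub>M\<^esub> x) = a \<odot>\<^bsub>N\<^esub> f x"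
  using assms by (auto simp: linear_on_def)

lemma linear_on_group_laws:
  assumes "module K M" and "module K N" and f: "linear_on K M N f"
  shows "f \<zero>\<^bsub>M\<^esub> = \<zero>\<^bsub>N\<^esub>"
    and "x \<in> carrier M \<Longrightarrow> f (\<ominus>\<^bsub>M\<^esub> x) = \<ominus>\<^bsub>N\<^esub> f x"
    and "\<lbrakk>x \<in> carrier M; y \<in> carrier M\<rbrakk> \<Longrightarrow> f (x \<ominus>\<^bsub>M\<^esub> y) = f x \<ominus>\<^bsub>N\<^esub> f y"
proof -
  interpret M: module K M by fact
  interpret N: module K N by fact
  note f = linear_onD [OF f]
  show zero: "f \<zero>\<^bsub>M\<^esub> = \<zero>\<^bsub>N\<^esub>"
    using f(2) [of "\<zero>\<^bsub>M\<^esub>" "\<zero>\<^bsub>M\<^esub>"] f(1) by (simp add: N.add.l_cancel_one)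
  show neg: "f (\<ominus>\<^bsub>M\<^esub> x) = \<ominus>\<^bsub>N\<^esub> f x" if "x \<in> carrier M" for x
    using f(2) [of "\<ominus>\<^bsub>M\<^esub> x" x] f(1) that zero by (simp add: M.l_neg N.minus_equality)
  show "f (x \<ominus>\<^bsub>M\<^esub> y) = f x \<ominus>\<^bsub>N\<^esub> f y" if "x \<in> carrier M" "y \<in> carrier M"
    using that by (simp add: M.minus_eq N.minus_eq f neg)
qed

lemma linear_on_id: "linear_on K M M (\<lambda>x. x)"
  by (simp add: linear_on_def)

lemma linear_on_comp:
  "\<lbrakk>linear_on K L M g; linear_on K M N f\<rbrakk> \<Longrightarrow> linear_on K L N (\<lambda>x. f (g x))"
  by (auto simp: linear_on_def Pi_iff)

lemma linear_on_neg:
  assumes "module K N" and f: "linear_on K M N f"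
  shows "linear_on K M N (\<lambda>x. \<ominus>\<^bsub>N\<^esub> f x)"
proof -
  interpret N: module K N by fact
  show ?thesis
    using linear_onD [OF f] by (auto simp: linear_on_def N.minus_add N.smult_r_minus)
qed

lemma linear_on_add:
  assumes "module K N" and f: "linear_on K M N f" and g: "linear_on K M N g"
  shows "linear_on K M N (\<lambda>x. f x \<oplus>\<^bsub>N\<^esub> g x)"
proof -
  interpret N: module K N by fact
  show ?thesis
    using linear_onD [OF f] linear_onD [OF g]
    by (auto simp: linear_on_def N.smult_r_distr N.M.a_ac)
qed

lemma linear_on_diff:
  assumes "module K N" and f: "linear_on K M N f" and g: "linear_on K M N g"
  shows "linear_on K M N (\<lambda>x. f x \<ominus>\<^bsub>N\<^esub> g x)"
  using linear_on_add [OF assms(1) f linear_on_neg [OF assms(1) g]]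
  by (simp add: a_minus_def)

lemma linear_maps_linear_on: "f \<in> linear_maps K M N \<Longrightarrow> linear_on K M N f"
  by (auto simp: linear_maps_def linear_on_def)

lemma linear_mapsI:
  assumes "module K M" and f: "linear_on K M N f"
  shows "(\<lambda>x \<in> carrier M. f x) \<in> linear_maps K M N"
proof -
  interpret M: module K M by fact
  show ?thesis
    using linear_onD [OF f] by (auto simp: linear_maps_def)
qed

lemma bilinear_maps_linear_on:
  assumes "module K L" and f: "f \<in> bilinear_maps K L M N"
  shows "x \<in> carrier L \<Longrightarrow> linear_on K M N (f x)"
    and "y \<in> carrier M \<Longrightarrow> linear_on K L N (\<lambda>x. f x y)"
proof -
  interpret L: module K L by fact
  show "x \<in> carrier L \<Longrightarrow> linear_on K M N (f x)"
    using f by (auto simp: bilinear_maps_def linear_maps_linear_on)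
  show "linear_on K L N (\<lambda>x. f x y)" if "y \<in> carrier M"
  proof -
    have "linear_on K L N (\<lambda>x \<in> carrier L. f x y)"
      using f that by (simp add: bilinear_maps_def linear_maps_linear_on)
    then show ?thesis
      by (auto simp: linear_on_def Pi_iff)
  qed
qed

lemma bilinear_mapsI:
  assumes "module K L" and "module K M"
    and right: "\<And>x. x \<in> carrier L \<Longrightarrow> linear_on K M N (f x)"
    and left: "\<And>y. y \<in> carrier M \<Longrightarrow> linear_on K L N (\<lambda>x. f x y)"
  shows "(\<lambda>x \<in> carrier L. \<lambda>y \<in> carrier M. f x y) \<in> bilinear_maps K L M N"
proof -
  \<comment> \<open>Fixing the second argument of a restricted map and restricting again gives the
    plain restriction, the form that \<open>linear_mapsI\<close> yields.\<close>
  have "(\<lambda>x \<in> carrier L. (\<lambda>x \<in> carrier L. \<lambda>y \<in> carrier M. f x y) x y) = (\<lambda>x \<in> carrier L. f x y)"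
    if "y \<in> carrier M" for y
    using that by auto
  then show ?thesis
    using linear_onD(1) [OF right]
    by (auto simp: bilinear_maps_def intro: linear_mapsI assms)
qed

lemma trilinear_mapsI:
  assumes "module K L" and "module K M" and "module K N"
    and "\<And>x y. \<lbrakk>x \<in> carrier L; y \<in> carrier M\<rbrakk> \<Longrightarrow> linear_on K N P (f x y)"
    and "\<And>x z. \<lbrakk>x \<in> carrier L; z \<in> carrier N\<rbrakk> \<Longrightarrow> linear_on K M P (\<lambda>y. f x y z)"
    and "\<And>y z. \<lbrakk>y \<in> carrier M; z \<in> carrier N\<rbrakk> \<Longrightarrow> linear_on K L P (\<lambda>x. f x y z)"
  shows "(\<lambda>x \<in> carrier L. \<lambda>y \<in> carrier M. \<lambda>z \<in> carrier N. f x y z) \<in> trilinear_maps K L M N P"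
proof -
  have "(\<lambda>x \<in> carrier L. (\<lambda>x \<in> carrier L. \<lambda>y \<in> carrier M. \<lambda>z \<in> carrier N. f x y z) x y z) =
      (\<lambda>x \<in> carrier L. f x y z)"
    if "y \<in> carrier M" "z \<in> carrier N" for y z
    using that by auto
  then show ?thesis
    using linear_onD(1) [OF assms(4)]
    by (auto simp: trilinear_maps_def intro: linear_mapsI bilinear_mapsI assms)
qed

text \<open>Polarization: expand \<open>f (x + y) (x + y) = 0\<close> and drop the two diagonal
  terms. As \<open>f\<close> need not be extensional, this applies directly to composite
  expressions.\<close>

lemma alternating_skew:
  assumes "module K M" and "module K N"
    and left: "\<And>y. y \<in> carrier M \<Longrightarrow> linear_on K M N (\<lambda>x. f x y)"
    and right: "\<And>x. x \<in> carrier M \<Longrightarrow> linear_on K M N (f x)"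
    and alt: "\<And>x. x \<in> carrier M \<Longrightarrow> f x x = \<zero>\<^bsub>N\<^esub>"
    and x: "x \<in> carrier M" and y: "y \<in> carrier M"
  shows "f x y = \<ominus>\<^bsub>N\<^esub> f y x"
proof -
  interpret M: module K M by fact
  interpret N: module K N by fact
  note [simp] = x y linear_onD [OF left] linear_onD [OF right]
  have "f x y \<oplus>\<^bsub>N\<^esub> f y x = f x (x \<oplus>\<^bsub>M\<^esub> y) \<oplus>\<^bsub>N\<^esub> f y (x \<oplus>\<^bsub>M\<^esub> y)"
    by (simp add: alt)
  also have "\<dots> = f (x \<oplus>\<^bsub>M\<^esub> y) (x \<oplus>\<^bsub>M\<^esub> y)"
    by (rule linear_onD(2) [OF left, symmetric]) simp_all
  also have "\<dots> = \<zero>\<^bsub>N\<^esub>"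
    by (simp only: alt M.add.m_closed x y)
  finally show ?thesis
    by (simp add: N.minus_equality)
qed

lemma linear_maps_closed: "\<lbrakk>f \<in> linear_maps K M N; x \<in> carrier M\<rbrakk> \<Longrightarrow> f x \<in> carrier N"
  unfolding linear_maps_def by (blast dest: PiE_mem)

lemma bilinear_maps_closed:
  "\<lbrakk>f \<in> bilinear_maps K L M N; x \<in> carrier L; y \<in> carrier M\<rbrakk> \<Longrightarrow> f x y \<in> carrier N"
  unfolding bilinear_maps_def by (blast dest: PiE_mem)

lemma trilinear_maps_closed:
  "\<lbrakk>f \<in> trilinear_maps K L M N P; x \<in> carrier L; y \<in> carrier M; z \<in> carrier N\<rbrakk>
    \<Longrightarrow> f x y z \<in> carrier P"
  unfolding trilinear_maps_def by (blast dest: PiE_mem)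

lemma alternating_maps_linear_on:
  assumes "module K V" and "\<beta> \<in> alternating_maps K V W"
  shows "x \<in> carrier V \<Longrightarrow> linear_on K V W (\<beta> x)"
    and "y \<in> carrier V \<Longrightarrow> linear_on K V W (\<lambda>x. \<beta> x y)"
  using assms bilinear_maps_linear_on [OF assms(1), of \<beta> V W] by (simp_all add: alternating_maps_def)

lemma alternating_maps_skew:
  assumes V: "module K V" and "module K W" and \<beta>: "\<beta> \<in> alternating_maps K V W"
    and "x \<in> carrier V" and "y \<in> carrier V"
  shows "\<beta> x y = \<ominus>\<^bsub>W\<^esub> \<beta> y x"
proof (rule alternating_skew [OF assms(1,2) alternating_maps_linear_on(2,1) [OF V \<beta>] _ assms(4,5)])
  show "\<beta> v v = \<zero>\<^bsub>W\<^esub>" if "v \<in> carrier V" for v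
    using \<beta> that by (simp add: alternating_maps_def)
qed

section \<open>The Lie 2-algebra of an enhanced Leibniz algebra\<close>

locale ela_char_not_2 = enhanced_leibniz_algebra K V br W t crc
  for K :: "('k, 'm) ring_scheme" and V :: "('k, 'v) module" and br
    and W :: "('k, 'w) module" and t and crc +
  assumes two_nonzero: "\<one>\<^bsub>K\<^esub> \<oplus>\<^bsub>K\<^esub> \<one>\<^bsub>K\<^esub> \<noteq> \<zero>\<^bsub>K\<^esub>"
begin

sublocale V: module K V
  by (rule module_V)

sublocale W: module K W
  by (rule module_W)

lemmas linear_ons =
  linear_maps_linear_on [OF t_linear]
  bilinear_maps_linear_on [OF module_V br_bilinear]
  bilinear_maps_linear_on [OF module_V crc_bilinear]

text \<open>With additivity in every slot as simplification rules, \<open>simp\<close> expands each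
  expression into a signed sum of monomials, ready for \<open>represents\<close>.\<close>

lemmas op_laws [simp] =
  linear_onD(1,2) [OF linear_ons(1)] linear_on_group_laws [OF module_W module_V linear_ons(1)]
  linear_onD(1,2) [OF linear_ons(2)] linear_on_group_laws [OF module_V module_V linear_ons(2)]
  linear_onD(1,2) [OF linear_ons(3)] linear_on_group_laws [OF module_V module_V linear_ons(3)]
  linear_onD(1,2) [OF linear_ons(4)] linear_on_group_laws [OF module_V module_W linear_ons(4)]
  linear_onD(1,2) [OF linear_ons(5)] linear_on_group_laws [OF module_V module_W linear_ons(5)]

lemmas linear_on_ops =
  linear_on_comp [OF _ linear_ons(1)]
  linear_on_comp [OF _ linear_ons(2)] linear_on_comp [OF _ linear_ons(3)]
  linear_on_comp [OF _ linear_ons(4)] linear_on_comp [OF _ linear_ons(5)]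

lemmas linear_on_intros =
  linear_on_add [OF module_V] linear_on_add [OF module_W]
  linear_on_diff [OF module_V] linear_on_diff [OF module_W]
  linear_on_neg [OF module_V] linear_on_neg [OF module_W]
  linear_on_ops linear_on_id

definition bracket :: "'v \<Rightarrow> 'v \<Rightarrow> 'v" where
  "bracket x y = br x y \<ominus>\<^bsub>V\<^esub> t (crc x y)"

definition act :: "'v \<Rightarrow> 'w \<Rightarrow> 'w" where
  "act x h = crc x (t h) \<oplus>\<^bsub>W\<^esub> crc (t h) x"

definition jacb :: "'v \<Rightarrow> 'v \<Rightarrow> 'v \<Rightarrow> 'w" where
  "jacb x y z = \<ominus>\<^bsub>W\<^esub> crc x (br y z) \<oplus>\<^bsub>W\<^esub> crc (br x y) z \<oplus>\<^bsub>W\<^esub> crc y (br x z)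
     \<ominus>\<^bsub>W\<^esub> crc (t (crc y z)) x \<ominus>\<^bsub>W\<^esub> crc (t (crc x y)) z \<oplus>\<^bsub>W\<^esub> crc (t (crc x z)) y"

lemma linear_on_bracket:
  "x \<in> carrier V \<Longrightarrow> linear_on K V V (bracket x)"
  "y \<in> carrier V \<Longrightarrow> linear_on K V V (\<lambda>x. bracket x y)"
  unfolding bracket_def by (intro linear_on_intros; assumption)+

lemma linear_on_act:
  "x \<in> carrier V \<Longrightarrow> linear_on K W W (act x)"
  "h \<in> carrier W \<Longrightarrow> linear_on K V W (\<lambda>x. act x h)"
  unfolding act_def by (intro linear_on_intros linear_ons; simp)+

lemma linear_on_jacb:
  "\<lbrakk>x \<in> carrier V; y \<in> carrier V\<rbrakk> \<Longrightarrow> linear_on K V W (\<lambda>z. jacb x y z)"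
  "\<lbrakk>x \<in> carrier V; z \<in> carrier V\<rbrakk> \<Longrightarrow> linear_on K V W (\<lambda>y. jacb x y z)"
  "\<lbrakk>y \<in> carrier V; z \<in> carrier V\<rbrakk> \<Longrightarrow> linear_on K V W (\<lambda>x. jacb x y z)"
  unfolding jacb_def by (intro linear_on_intros; simp)+

lemmas bracket_act_laws [simp] =
  linear_onD(1,2) [OF linear_on_bracket(1)]
  linear_on_group_laws [OF module_V module_V linear_on_bracket(1)]
  linear_onD(1,2) [OF linear_on_bracket(2)]
  linear_on_group_laws [OF module_V module_V linear_on_bracket(2)]
  linear_onD(1,2) [OF linear_on_act(1)] linear_on_group_laws [OF module_W module_W linear_on_act(1)]
  linear_onD(1,2) [OF linear_on_act(2)] linear_on_group_laws [OF module_V module_W linear_on_act(2)]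
  linear_onD(1) [OF linear_on_jacb(1)]

lemmas V_eqI = V.M.represents_unique
lemmas W_eqI = W.M.represents_unique

section \<open>The skew bracket and the action of \<open>V\<close> on \<open>W\<close>\<close>

lemma bracket_self: "x \<in> carrier V \<Longrightarrow> bracket x x = \<zero>\<^bsub>V\<^esub>"
  by (simp add: bracket_def br_square V.minus_eq V.r_neg)

lemma bracket_skew:
  assumes "x \<in> carrier V" and "y \<in> carrier V"
  shows "bracket x y = \<ominus>\<^bsub>V\<^esub> bracket y x"
  by (rule alternating_skew [OF module_V module_V linear_on_bracket(2,1) bracket_self assms])

lemma crc_t_t_skew:
  assumes "h \<in> carrier W" and "k \<in> carrier W"
  shows "crc (t h) (t k) = \<ominus>\<^bsub>W\<^esub> crc (t k) (t h)"
  by (rule alternating_skew [where f = "\<lambda>h k. crc (t h) (t k)", OF module_W module_W _ _ crc_t_t assms])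
    (intro linear_on_intros linear_ons; simp)+

text \<open>Axiom (a) reduces \<open>bracket (t h) x\<close> to minus
  \<open>t (crc (t h) x)\<close>; skewness of the bracket gives the rest. This is the compatibility
  of \<open>t\<close> with the degree 0-1 bracket.\<close>

lemma t_crc_t: "\<lbrakk>x \<in> carrier V; h \<in> carrier W\<rbrakk> \<Longrightarrow> t (crc (t h) x) = bracket x (t h)"
  using bracket_skew [of x "t h"] by (simp add: bracket_def br_t V.minus_eq)

lemma t_act: "\<lbrakk>x \<in> carrier V; h \<in> carrier W\<rbrakk> \<Longrightarrow> t (act x h) = br x (t h)"
  by (simp add: act_def t_crc_t bracket_def V.minus_eq V.M.a_ac V.r_neg V.r_neg1)

lemma act_t: "\<lbrakk>h \<in> carrier W; k \<in> carrier W\<rbrakk> \<Longrightarrow> act (t h) k = \<zero>\<^bsub>W\<^esub>"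
  using crc_t_t_skew [of h k] by (simp add: act_def W.l_neg)

text \<open>Axiom (c) with the factor one half cleared: two is a unit because the characteristic is
  not 2.\<close>

lemma sym_br_doubled:
  assumes u: "u \<in> carrier V" and v: "v \<in> carrier V"
  shows "crc u (br v v) \<oplus>\<^bsub>W\<^esub> crc (br v v) u = crc v (br u v) \<oplus>\<^bsub>W\<^esub> crc (br u v) v"
proof -
  interpret K: field K
    by (rule field_K)
  let ?two = "\<one>\<^bsub>K\<^esub> \<oplus>\<^bsub>K\<^esub> \<one>\<^bsub>K\<^esub>"
  have two: "?two \<in> Units K"
    using two_nonzero by (simp add: K.field_Units)
  have cancel: "?two \<odot>\<^bsub>W\<^esub> (inv\<^bsub>K\<^esub> ?two \<odot>\<^bsub>W\<^esub> h) = h" if "h \<in> carrier W" for h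
    using that two by (simp add: W.smult_assoc1 [symmetric] V.Units_r_inv)
  have "?two \<odot>\<^bsub>W\<^esub> half_sym K W crc u (br v v) = ?two \<odot>\<^bsub>W\<^esub> half_sym K W crc v (br u v)"
    using sym_br [OF u v] by simp
  then show ?thesis
    using u v by (simp add: half_sym_def cancel)
qed

text \<open>The failure of \<open>u\<close> to act on \<open>crc\<close> as a derivation is
  alternating: on the diagonal, \<open>t (crc v v) = br v v\<close> turns
  \<open>act u (crc v v)\<close> into the left side of \<open>sym_br_doubled\<close>.\<close>

lemma act_crc_skew:
  assumes "u \<in> carrier V" and "v \<in> carrier V" and "w \<in> carrier V"
  shows "act u (crc v w) \<ominus>\<^bsub>W\<^esub> crc (br u v) w \<ominus>\<^bsub>W\<^esub> crc v (br u w)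
    = \<ominus>\<^bsub>W\<^esub> (act u (crc w v) \<ominus>\<^bsub>W\<^esub> crc (br u w) v \<ominus>\<^bsub>W\<^esub> crc w (br u v))" (is "?f v w = _")
proof (rule alternating_skew [where f = ?f, OF module_V module_W _ _ _ assms(2,3)])
  show "?f x x = \<zero>\<^bsub>W\<^esub>" if "x \<in> carrier V" for x
    using that assms(1) sym_br_doubled [of u x]
    by (simp add: act_def br_square [symmetric] W.minus_eq W.a_ac W.r_neg W.r_neg1)
qed (use assms(1) in \<open>intro linear_on_intros linear_on_comp [OF _ linear_on_act(1)]; simp\<close>)+

text \<open>Put \<open>w = t h\<close> in \<open>act_crc_skew\<close>: the two mixed products add up
  to \<open>act u (act v h)\<close>, and the terms containing \<open>br u (t h)\<close> form
  \<open>act v (act u h)\<close> by \<open>t_act\<close>.\<close>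

lemma act_br:
  assumes [simp]: "u \<in> carrier V" "v \<in> carrier V" "h \<in> carrier W"
  shows "act (br u v) h = act u (act v h) \<ominus>\<^bsub>W\<^esub> act v (act u h)"
proof -
  have 1: "act u (crc v (t h)) = \<ominus>\<^bsub>W\<^esub> (act u (crc (t h) v) \<ominus>\<^bsub>W\<^esub> crc (br u (t h)) v \<ominus>\<^bsub>W\<^esub> crc (t h) (br u v))
     \<oplus>\<^bsub>W\<^esub> crc (br u v) (t h) \<oplus>\<^bsub>W\<^esub> crc v (br u (t h))"
    \<comment> \<open>Folds the negated parenthesis back into the left side of
      \<open>act_crc_skew\<close>, after which only cancellation remains.\<close>
    unfolding act_crc_skew [of u v "t h", simplified, symmetric]
    by (rule W_eqI, (rule represents.intros | simp; fail)+)
  have 2: "act v (act u h) = crc v (br u (t h)) \<oplus>\<^bsub>W\<^esub> crc (br u (t h)) v"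
    by (simp add: act_def [of v "act u h"] t_act)
  show ?thesis
    unfolding 2 unfolding act_def [of v] act_def [of "br u v"]
    by (simp add: 1,
        rule W_eqI, (rule represents.intros | simp; fail)+)
qed

text \<open>\<open>bracket\<close> and \<open>br\<close> differ by an element of the image of
  \<open>t\<close>, which acts as zero by polarized axiom (b).\<close>

lemma act_bracket:
  assumes "u \<in> carrier V" "v \<in> carrier V" "h \<in> carrier W"
  shows "act (bracket u v) h = act u (act v h) \<ominus>\<^bsub>W\<^esub> act v (act u h)"
  using assms by (simp add: bracket_def act_t act_br W.minus_eq)

section \<open>The jacobiator and its identities\<close>

text \<open>Replacing \<open>br\<close> by \<open>bracket\<close> introduces
  \<open>crc x (t (crc y z))\<close> and \<open>crc y (t (crc x z))\<close>; the two action terms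
  cancel these and supply the terms with the factors exchanged.\<close>

lemma jacb_eq:
  assumes [simp]: "x \<in> carrier V" "y \<in> carrier V" "z \<in> carrier V"
  shows "jacb x y z = crc (bracket x y) z \<ominus>\<^bsub>W\<^esub> crc x (bracket y z) \<oplus>\<^bsub>W\<^esub> crc y (bracket x z)
    \<ominus>\<^bsub>W\<^esub> act x (crc y z) \<oplus>\<^bsub>W\<^esub> act y (crc x z)"
  by (simp add: jacb_def bracket_def act_def,
      rule W_eqI, (rule represents.intros | simp; fail)+)

text \<open>Under \<open>t\<close>, each product becomes the difference of the two brackets and each
  action becomes \<open>br\<close>. The resulting \<open>br\<close> terms cancel by the Leibniz
  identity, since the first argument of \<open>br\<close> matters only modulo the image of
  \<open>t\<close>.\<close>

lemma t_jacb:
  assumes [simp]: "x \<in> carrier V" "y \<in> carrier V" "z \<in> carrier V"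
  shows "t (jacb x y z) = \<ominus>\<^bsub>V\<^esub> bracket (bracket x y) z \<oplus>\<^bsub>V\<^esub> bracket (bracket x z) y
    \<oplus>\<^bsub>V\<^esub> bracket x (bracket y z)"
proof -
  have t_crc: "t (crc u v) = br u v \<ominus>\<^bsub>V\<^esub> bracket u v" if "u \<in> carrier V" "v \<in> carrier V" for u v
    unfolding bracket_def by (rule V_eqI, (rule represents.intros | simp add: that; fail)+)
  have br_bracket: "br (bracket u v) w = br (br u v) w"
    if "u \<in> carrier V" "v \<in> carrier V" "w \<in> carrier V" for u v w
    using that by (simp add: bracket_def br_t V.minus_eq)
  show ?thesis
    by (simp add: jacb_eq t_crc t_act br_bracket leibniz [of x y z] bracket_skew [of "bracket x z" y],
        rule V_eqI, (rule represents.intros | simp; fail)+)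
qed

lemma jacb_t:
  assumes [simp]: "h \<in> carrier W" "x \<in> carrier V" "y \<in> carrier V"
  shows "jacb (t h) x y = \<ominus>\<^bsub>W\<^esub> crc (t h) (bracket x y) \<ominus>\<^bsub>W\<^esub> crc (t (crc (t h) x)) y
    \<oplus>\<^bsub>W\<^esub> crc (t (crc (t h) y)) x"
proof -
  have *: "bracket (t h) u = \<ominus>\<^bsub>V\<^esub> t (crc (t h) u)" if "u \<in> carrier V" for u
    using that by (simp add: bracket_def br_t V.minus_eq)
  show ?thesis
    \<comment> \<open>\<open>act (t h)\<close> must vanish through \<open>act_t\<close> before
      \<open>act\<close> is unfolded for the other action term.\<close>
    by (simp add: jacb_eq * act_t,
        simp add: act_def,
        rule W_eqI, (rule represents.intros | simp; fail)+)
qed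

lemma jacb_skew_left:
  assumes [simp]: "x \<in> carrier V" "y \<in> carrier V" "z \<in> carrier V"
  shows "jacb x y z = \<ominus>\<^bsub>W\<^esub> jacb y x z"
proof (rule alternating_skew [where f = "\<lambda>x y. jacb x y z", OF module_V module_W])
  show "jacb u u z = \<zero>\<^bsub>W\<^esub>" if [simp]: "u \<in> carrier V" for u
    by (simp add: jacb_eq bracket_self,
        rule W_eqI, (rule represents.intros | simp; fail)+)
qed (simp_all add: linear_on_jacb)

text \<open>When the last two arguments agree, the terms with \<open>t (crc x u)\<close> cancel, and
  what is left is the difference of the two sides of axiom (c).\<close>

lemma jacb_skew_right:
  assumes [simp]: "x \<in> carrier V" "y \<in> carrier V" "z \<in> carrier V"
  shows "jacb x y z = \<ominus>\<^bsub>W\<^esub> jacb x z y"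
proof (rule alternating_skew [where f = "jacb x", OF module_V module_W])
  show "jacb x u u = \<zero>\<^bsub>W\<^esub>" if [simp]: "u \<in> carrier V" for u
  proof -
    have *: "crc (br x u) u = crc x (br u u) \<oplus>\<^bsub>W\<^esub> crc (br u u) x \<ominus>\<^bsub>W\<^esub> crc u (br x u)"
      unfolding sym_br_doubled [of x u, simplified]
      by (rule W_eqI, (rule represents.intros | simp; fail)+)
    show ?thesis
      by (simp add: jacb_def * br_square [symmetric],
          rule W_eqI, (rule represents.intros | simp; fail)+)
  qed
qed (simp_all add: linear_on_jacb)

text \<open>By the definition of \<open>act\<close>, the product with \<open>t (jacb x y z)\<close>
  on the left is traded for an action of \<open>w\<close> and a product on the right, whose factor
  \<open>t (jacb x y z)\<close> is known from \<open>t_jacb\<close>.\<close>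

lemma crc_t_jacb:
  assumes [simp]: "w \<in> carrier V" "x \<in> carrier V" "y \<in> carrier V" "z \<in> carrier V"
  shows "crc (t (jacb x y z)) w =
    act w (crc (bracket x y) z) \<ominus>\<^bsub>W\<^esub> act w (crc x (bracket y z)) \<oplus>\<^bsub>W\<^esub> act w (crc y (bracket x z))
    \<ominus>\<^bsub>W\<^esub> act w (act x (crc y z)) \<oplus>\<^bsub>W\<^esub> act w (act y (crc x z)) \<ominus>\<^bsub>W\<^esub> crc w (t (jacb x y z))"
proof -
  have "crc (t (jacb x y z)) w = act w (jacb x y z) \<ominus>\<^bsub>W\<^esub> crc w (t (jacb x y z))"
    unfolding act_def
    by (rule W_eqI, (rule represents.intros | simp; fail)+)
  then show ?thesis
    by (simp add: jacb_eq)
qed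

text \<open>This is the coherence law (i) with \<open>b10 h x\<close> replaced by minus
  \<open>crc (t h) x\<close>, which explains the double signs. After expansion,
  \<open>act_bracket\<close> splits the actions of brackets into iterated actions.\<close>

lemma jacobiator_identity:
  assumes [simp]: "w \<in> carrier V" "x \<in> carrier V" "y \<in> carrier V" "z \<in> carrier V"
  shows "\<ominus>\<^bsub>W\<^esub> crc (t (jacb w x y)) z \<oplus>\<^bsub>W\<^esub> \<ominus>\<^bsub>W\<^esub> crc (t (jacb w y z)) x
      \<ominus>\<^bsub>W\<^esub> \<ominus>\<^bsub>W\<^esub> crc (t (jacb w x z)) y \<ominus>\<^bsub>W\<^esub> \<ominus>\<^bsub>W\<^esub> crc (t (jacb x y z)) w
      \<oplus>\<^bsub>W\<^esub> jacb (bracket x z) w y \<oplus>\<^bsub>W\<^esub> jacb (bracket w y) x z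
      \<ominus>\<^bsub>W\<^esub> jacb (bracket w x) y z \<ominus>\<^bsub>W\<^esub> jacb (bracket w z) x y
      \<ominus>\<^bsub>W\<^esub> jacb (bracket x y) w z \<ominus>\<^bsub>W\<^esub> jacb (bracket y z) w x = \<zero>\<^bsub>W\<^esub>"
proof -
  have rotate: "jacb u v c = jacb v c u"
    if "u \<in> carrier V" "v \<in> carrier V" "c \<in> carrier V" for u v c
    using that jacb_skew_left [of u v c] jacb_skew_right [of v u c] by simp
  \<comment> \<open>Moves \<open>z\<close> into an inner bracket or the last slot everywhere, so that after expansion only \<open>w\<close>,
    \<open>x\<close>, \<open>y\<close> act, and the terms cancel in groups according to which of them acts outermost.\<close>
  have rotates:
    "jacb (bracket x z) w y = jacb w y (bracket x z)"
    "jacb (bracket w z) x y = jacb x y (bracket w z)"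
    "jacb (bracket y z) w x = jacb w x (bracket y z)"
    by (rule rotate; simp)+
  \<comment> \<open>One representative is chosen for each iterated bracket, so that terms equal up
    to skewness become syntactically equal.\<close>
  have skews:
    "bracket (bracket x z) y = \<ominus>\<^bsub>V\<^esub> bracket y (bracket x z)"
    "bracket (bracket w y) x = \<ominus>\<^bsub>V\<^esub> bracket x (bracket w y)"
    "bracket (bracket w z) x = \<ominus>\<^bsub>V\<^esub> bracket x (bracket w z)"
    "bracket (bracket w z) y = \<ominus>\<^bsub>V\<^esub> bracket y (bracket w z)"
    "bracket (bracket x y) w = \<ominus>\<^bsub>V\<^esub> bracket w (bracket x y)"
    by (rule bracket_skew; simp)+
  \<comment> \<open>Here \<open>z\<close> already stands in the last slot of \<open>crc\<close>, so
    \<open>t_jacb\<close> is inserted directly and no action of \<open>z\<close> appears.\<close>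
  have expand: "crc (t (jacb w x y)) z = \<ominus>\<^bsub>W\<^esub> crc (bracket (bracket w x) y) z
      \<ominus>\<^bsub>W\<^esub> crc (bracket x (bracket w y)) z \<oplus>\<^bsub>W\<^esub> crc (bracket w (bracket x y)) z"
    by (simp add: t_jacb skews W.minus_eq)
  show ?thesis
    unfolding rotates expand crc_t_jacb [OF assms(1,2,3,4)] crc_t_jacb [OF assms(2,1,3,4)]
      crc_t_jacb [OF assms(3,1,2,4)]
    \<comment> \<open>All occurrences of \<open>t (jacb ...)\<close> are evaluated first; afterwards
      \<open>jacb_eq\<close> can expand the remaining jacobiators without rewriting beneath
      \<open>t\<close>.\<close>
    by (simp add: t_jacb skews,
        simp add: jacb_eq act_bracket skews,
        rule W_eqI, (rule represents.intros | simp; fail)+)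
qed

lemma lie_2_algebra_bracket:
  "lie_2_algebra K V W t
     (\<lambda>x \<in> carrier V. \<lambda>y \<in> carrier V. bracket x y)
     (\<lambda>x \<in> carrier V. \<lambda>h \<in> carrier W. crc (t h) x)
     (\<lambda>h \<in> carrier W. \<lambda>x \<in> carrier V. \<ominus>\<^bsub>W\<^esub> crc (t h) x)
     (\<lambda>x \<in> carrier V. \<lambda>y \<in> carrier V. \<lambda>z \<in> carrier V. jacb x y z)"
    (is "lie_2_algebra K V W t ?b00 ?b01 ?b10 ?l3")
proof (intro lie_2_algebra.intro field_K module_V module_W t_linear)
  show "?b00 \<in> bilinear_maps K V V V"
    by (intro bilinear_mapsI module_V linear_on_bracket)
  show "?b01 \<in> bilinear_maps K V W W"
    by (intro bilinear_mapsI module_V module_W linear_on_intros linear_ons; simp)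
  show "?b10 \<in> bilinear_maps K W V W"
    by (intro bilinear_mapsI module_V module_W linear_on_intros linear_ons; simp)
  show "?l3 \<in> trilinear_maps K V V V W"
    by (intro trilinear_mapsI module_V linear_on_jacb)
next
  fix x y assume [simp]: "x \<in> carrier V" "y \<in> carrier V"
  show "?b00 x y = \<ominus>\<^bsub>V\<^esub> ?b00 y x"
    by (simp add: bracket_skew [of x y])
next
  fix x h assume [simp]: "x \<in> carrier V" "h \<in> carrier W"
  show "?b01 x h = \<ominus>\<^bsub>W\<^esub> ?b10 h x"
    by simp
  show "t (?b01 x h) = ?b00 x (t h)"
    by (simp add: t_crc_t)
next
  fix x y z assume [simp]: "x \<in> carrier V" "y \<in> carrier V" "z \<in> carrier V"
  \<comment> \<open>Exchanging the outer arguments is a product of three adjacent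
    transpositions.\<close>
  have "jacb x y z = \<ominus>\<^bsub>W\<^esub> jacb z y x"
    using jacb_skew_left [of x y z] jacb_skew_right [of y x z] jacb_skew_left [of y z x] by simp
  then show "?l3 x y z = \<ominus>\<^bsub>W\<^esub> ?l3 y x z \<and> ?l3 x y z = \<ominus>\<^bsub>W\<^esub> ?l3 x z y \<and> ?l3 x y z = \<ominus>\<^bsub>W\<^esub> ?l3 z y x"
    using jacb_skew_left [of x y z] jacb_skew_right [of x y z] by simp
  show "t (?l3 x y z) = \<ominus>\<^bsub>V\<^esub> ?b00 (?b00 x y) z \<oplus>\<^bsub>V\<^esub> ?b00 (?b00 x z) y \<oplus>\<^bsub>V\<^esub> ?b00 x (?b00 y z)"
    by (simp add: t_jacb)
next
  fix h k assume [simp]: "h \<in> carrier W" "k \<in> carrier W"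
  show "?b01 (t h) k = ?b10 h (t k)"
    by (simp add: crc_t_t_skew [of k h])
next
  fix h x y assume [simp]: "h \<in> carrier W" "x \<in> carrier V" "y \<in> carrier V"
  show "?l3 (t h) x y = \<ominus>\<^bsub>W\<^esub> ?b01 (?b00 x y) h \<oplus>\<^bsub>W\<^esub> ?b10 (?b01 x h) y \<oplus>\<^bsub>W\<^esub> ?b01 x (?b01 y h)"
    by (simp add: jacb_t W.minus_eq)
next
  fix w x y z assume "w \<in> carrier V" "x \<in> carrier V" "y \<in> carrier V" "z \<in> carrier V"
  then show "?b10 (?l3 w x y) z \<oplus>\<^bsub>W\<^esub> ?b10 (?l3 w y z) x \<ominus>\<^bsub>W\<^esub> ?b10 (?l3 w x z) y
      \<ominus>\<^bsub>W\<^esub> ?b10 (?l3 x y z) w \<oplus>\<^bsub>W\<^esub> ?l3 (?b00 x z) w y \<oplus>\<^bsub>W\<^esub> ?l3 (?b00 w y) x z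
      \<ominus>\<^bsub>W\<^esub> ?l3 (?b00 w x) y z \<ominus>\<^bsub>W\<^esub> ?l3 (?b00 w z) x y \<ominus>\<^bsub>W\<^esub> ?l3 (?b00 x y) w z
      \<ominus>\<^bsub>W\<^esub> ?l3 (?b00 y z) w x = \<zero>\<^bsub>W\<^esub>"
    using jacobiator_identity [of w x y z] by simp
qed

section \<open>Changing the product by an alternating map\<close>

text \<open>The axioms see the product only on the diagonal and through its symmetrization, and an
  alternating \<open>\<beta>\<close> contributes zero to both.\<close>

lemma enhanced_leibniz_algebra_beta:
  assumes \<beta>: "\<beta> \<in> alternating_maps K V W"
  shows "enhanced_leibniz_algebra K V br W t
    (\<lambda>u \<in> carrier V. \<lambda>v \<in> carrier V. crc u v \<oplus>\<^bsub>W\<^esub> \<beta> u v)"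
    (is "enhanced_leibniz_algebra K V br W t ?crc")
proof
  note lin = alternating_maps_linear_on [OF module_V \<beta>]
  note [simp] = linear_onD(1,2) [OF lin(1)] linear_onD(1,2) [OF lin(2)]
  have alt [simp]: "\<beta> v v = \<zero>\<^bsub>W\<^esub>" if "v \<in> carrier V" for v
    using \<beta> that by (simp add: alternating_maps_def)
  have half_sym: "half_sym K W ?crc u v = half_sym K W crc u v"
    if [simp]: "u \<in> carrier V" "v \<in> carrier V" for u v
  proof -
    have "crc u v \<oplus>\<^bsub>W\<^esub> \<beta> u v \<oplus>\<^bsub>W\<^esub> (crc v u \<oplus>\<^bsub>W\<^esub> \<beta> v u) = crc u v \<oplus>\<^bsub>W\<^esub> crc v u"
      unfolding alternating_maps_skew [OF module_V module_W \<beta> that]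
      by (rule W_eqI, (rule represents.intros | simp; fail)+)
    then show ?thesis
      by (simp add: half_sym_def)
  qed
  show "?crc \<in> bilinear_maps K V V W"
    by (rule bilinear_mapsI [OF module_V module_V])
      (rule linear_on_add [OF module_W]; (rule linear_ons lin); assumption)+
  show "?crc (t w) (t w) = \<zero>\<^bsub>W\<^esub>" if "w \<in> carrier W" for w
    using that by (simp add: crc_t_t)
  show "half_sym K W ?crc u (br v v) = half_sym K W ?crc v (br u v)"
    if "u \<in> carrier V" "v \<in> carrier V" for u v
    using sym_br [OF that] that by (simp add: half_sym)
  show "br v v = t (?crc v v)" if "v \<in> carrier V" for v
    using that by (simp add: br_square)
qed (fact module_W t_linear br_t)+

text \<open>Sort by degree in \<open>\<beta>\<close>: the linear terms form \<open>Dbar\<close>,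
  where \<open>\<beta>\<close> of \<open>br\<close> and \<open>\<beta>\<close> of
  \<open>t (crc ...)\<close> merge into \<open>\<beta>\<close> of \<open>bracket\<close>; the
  quadratic terms form the cyclic sum.\<close>

lemma jacb_beta:
  assumes \<beta>: "\<beta> \<in> alternating_maps K V W"
    and [simp]: "x \<in> carrier V" "y \<in> carrier V" "z \<in> carrier V"
  defines "crc' \<equiv> \<lambda>u v. crc u v \<oplus>\<^bsub>W\<^esub> \<beta> u v"
  shows "\<ominus>\<^bsub>W\<^esub> crc' x (br y z) \<oplus>\<^bsub>W\<^esub> crc' (br x y) z \<oplus>\<^bsub>W\<^esub> crc' y (br x z)
     \<ominus>\<^bsub>W\<^esub> crc' (t (crc' y z)) x \<ominus>\<^bsub>W\<^esub> crc' (t (crc' x y)) z \<oplus>\<^bsub>W\<^esub> crc' (t (crc' x z)) y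
   = jacb x y z
     \<ominus>\<^bsub>W\<^esub> (crc (t (\<beta> y z)) x \<ominus>\<^bsub>W\<^esub> crc (t (\<beta> x z)) y \<oplus>\<^bsub>W\<^esub> crc (t (\<beta> x y)) z
       \<ominus>\<^bsub>W\<^esub> \<beta> (bracket x y) z \<oplus>\<^bsub>W\<^esub> \<beta> (bracket x z) y \<ominus>\<^bsub>W\<^esub> \<beta> (bracket y z) x)
     \<ominus>\<^bsub>W\<^esub> (\<beta> (t (\<beta> x y)) z \<oplus>\<^bsub>W\<^esub> \<beta> (t (\<beta> y z)) x \<oplus>\<^bsub>W\<^esub> \<beta> (t (\<beta> z x)) y)"
proof -
  note lin = alternating_maps_linear_on [OF module_V \<beta>]
  note [simp] = linear_onD(1,2) [OF lin(1)] linear_on_group_laws [OF module_V module_W lin(1)]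
    linear_onD(1,2) [OF lin(2)] linear_on_group_laws [OF module_V module_W lin(2)]
  have skews: "\<beta> x (br y z) = \<ominus>\<^bsub>W\<^esub> \<beta> (br y z) x" "\<beta> y (br x z) = \<ominus>\<^bsub>W\<^esub> \<beta> (br x z) y"
    "\<beta> z x = \<ominus>\<^bsub>W\<^esub> \<beta> x z"
    by (rule alternating_maps_skew [OF module_V module_W \<beta>]; simp)+
  show ?thesis
    unfolding crc'_def jacb_def bracket_def skews
    by (simp, rule W_eqI, (rule represents.intros | simp; fail)+)
qed

end

section \<open>The two categories\<close>

text \<open>The typing data behind the category laws: linearity makes composition associative and
  unital, and extensionality lets arrows be compared on carriers.\<close>

definition complex_arrow ::
  "('k, 'm) ring_scheme \<Rightarrow> (('k, 'v, 'w, 'x) two_term_scheme, 'v, 'w) arrow \<Rightarrow> bool" where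
  "complex_arrow K f \<longleftrightarrow>
     map1 f \<in> linear_maps K (sp1 (src f)) (sp1 (tgt f)) \<and>
     map0 f \<in> linear_maps K (sp0 (src f)) (sp0 (tgt f)) \<and>
     hty f \<in> carrier (sp0 (src f)) \<rightarrow>\<^sub>E carrier (sp0 (src f)) \<rightarrow>\<^sub>E carrier (sp1 (tgt f))"

lemma complex_arrowD:
  assumes "complex_arrow K f"
  shows "linear_on K (sp1 (src f)) (sp1 (tgt f)) (map1 f)"
    and "linear_on K (sp0 (src f)) (sp0 (tgt f)) (map0 f)"
    and "map1 f \<in> extensional (carrier (sp1 (src f)))"
    and "map0 f \<in> extensional (carrier (sp0 (src f)))"
    and "\<lbrakk>u \<in> carrier (sp0 (src f)); v \<in> carrier (sp0 (src f))\<rbrakk> \<Longrightarrow> hty f u v \<in> carrier (sp1 (tgt f))"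
    and "u \<in> carrier (sp0 (src f)) \<Longrightarrow> hty f u \<in> extensional (carrier (sp0 (src f)))"
    and "hty f \<in> extensional (carrier (sp0 (src f)))"
  using assms
  by (auto simp: complex_arrow_def linear_maps_linear_on) (auto simp: linear_maps_def PiE_iff)

section \<open>Composition and equality of arrows\<close>

lemma complex_arrow_comp:
  assumes "module K (sp0 (src f))" and "module K (sp1 (src f))" and "module K (sp1 (tgt g))"
    and f: "complex_arrow K f" and g: "complex_arrow K g" and fg: "tgt f = src g"
  shows "complex_arrow K (comp_arrow g f)"
proof -
  interpret N: module K "sp1 (tgt g)" by fact
  note F = complex_arrowD [OF f, unfolded fg] and G = complex_arrowD [OF g]
  have "compose (carrier (sp1 (src f))) (map1 g) (map1 f) \<in> linear_maps K (sp1 (src f)) (sp1 (tgt g))"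
    "compose (carrier (sp0 (src f))) (map0 g) (map0 f) \<in> linear_maps K (sp0 (src f)) (sp0 (tgt g))"
    unfolding compose_def
    by (fact linear_mapsI [OF assms(2) linear_on_comp [OF F(1) G(1)]]
        linear_mapsI [OF assms(1) linear_on_comp [OF F(2) G(2)]])+
  moreover have "map1 g (hty f u v) \<oplus>\<^bsub>sp1 (tgt g)\<^esub> hty g (map0 f u) (map0 f v) \<in> carrier (sp1 (tgt g))"
    if "u \<in> carrier (sp0 (src f))" "v \<in> carrier (sp0 (src f))" for u v
    using that by (intro N.M.add.m_closed F G linear_onD(1) [OF G(1)] linear_onD(1) [OF F(2)])
  ultimately show ?thesis
    by (auto simp: complex_arrow_def comp_arrow_def)
qed

lemma map1_comp_arrow: "h \<in> carrier (sp1 (src f)) \<Longrightarrow> map1 (comp_arrow g f) h = map1 g (map1 f h)"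
  and map0_comp_arrow: "x \<in> carrier (sp0 (src f)) \<Longrightarrow> map0 (comp_arrow g f) x = map0 g (map0 f x)"
  by (simp_all add: comp_arrow_def compose_eq)

lemma hty_comp_arrow:
  "\<lbrakk>u \<in> carrier (sp0 (src f)); v \<in> carrier (sp0 (src f))\<rbrakk>
    \<Longrightarrow> hty (comp_arrow g f) u v = map1 g (hty f u v) \<oplus>\<^bsub>sp1 (tgt g)\<^esub> hty g (map0 f u) (map0 f v)"
  by (simp add: comp_arrow_def)

lemma src_comp_arrow [simp]: "src (comp_arrow g f) = src f"
  and tgt_comp_arrow [simp]: "tgt (comp_arrow g f) = tgt g"
  by (simp_all add: comp_arrow_def)

lemma id_arrow_simps [simp]:
  "src (id_arrow A) = A" "tgt (id_arrow A) = A"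
  "h \<in> carrier (sp1 A) \<Longrightarrow> map1 (id_arrow A) h = h"
  "x \<in> carrier (sp0 A) \<Longrightarrow> map0 (id_arrow A) x = x"
  "\<lbrakk>x \<in> carrier (sp0 A); y \<in> carrier (sp0 A)\<rbrakk> \<Longrightarrow> hty (id_arrow A) x y = \<zero>\<^bsub>sp1 A\<^esub>"
  by (simp_all add: id_arrow_def plain_arrow_def)

lemma complex_arrow_eqI:
  assumes f: "complex_arrow K f" and g: "complex_arrow K g"
    and src: "src f = src g" and tgt: "tgt f = tgt g"
    and "\<And>h. h \<in> carrier (sp1 (src g)) \<Longrightarrow> map1 f h = map1 g h"
    and "\<And>x. x \<in> carrier (sp0 (src g)) \<Longrightarrow> map0 f x = map0 g x"
    and "\<And>x y. \<lbrakk>x \<in> carrier (sp0 (src g)); y \<in> carrier (sp0 (src g))\<rbrakk> \<Longrightarrow> hty f x y = hty g x y"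
  shows "f = g"
proof -
  note F = complex_arrowD [OF f, unfolded src] and G = complex_arrowD [OF g]
  have "map1 f = map1 g"
    using F(3) G(3) assms(5) by (rule extensionalityI)
  moreover have "map0 f = map0 g"
    using F(4) G(4) assms(6) by (rule extensionalityI)
  moreover have "hty f = hty g"
    using F(7) G(7) by (rule extensionalityI) (blast intro: extensionalityI F(6) G(6) assms(7))
  ultimately show ?thesis
    using src tgt by (cases f; cases g) simp
qed

lemma complex_arrow_plain:
  assumes "module K (sp1 B)"
    and "\<phi> \<in> linear_maps K (sp1 A) (sp1 B)" and "\<psi> \<in> linear_maps K (sp0 A) (sp0 B)"
  shows "complex_arrow K (plain_arrow A B \<phi> \<psi>)"
proof -
  interpret N: module K "sp1 B" by fact
  show ?thesis
    using assms by (simp add: complex_arrow_def plain_arrow_def)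
qed

lemma identity_linear_maps: "module K M \<Longrightarrow> (\<lambda>x \<in> carrier M. x) \<in> linear_maps K M M"
  by (rule linear_mapsI [OF _ linear_on_id])

lemma complex_arrow_beta:
  assumes "module K (sp0 A)" and "module K (sp1 A)"
    and "sp0 B = sp0 A" and "sp1 B = sp1 A" and "\<beta> \<in> alternating_maps K (sp0 A) (sp1 A)"
  shows "complex_arrow K (beta_arrow A B \<beta>)"
  using assms
  by (simp add: complex_arrow_def beta_arrow_def identity_linear_maps alternating_maps_def bilinear_maps_def)

lemma elas_module:
  assumes "A \<in> elas K"
  shows "module K (sp0 A)" and "module K (sp1 A)"
proof -
  interpret enhanced_leibniz_algebra K "sp0 A" "lbr A" "sp1 A" "tmap A" "circ A"
    using assms by (simp add: elas_def)
  show "module K (sp0 A)" and "module K (sp1 A)"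
    by (fact module_V module_W)+
qed

lemma lie2s_module:
  assumes "L \<in> lie2s K"
  shows "module K (sp0 L)" and "module K (sp1 L)"
proof -
  interpret lie_2_algebra K "sp0 L" "sp1 L" "tmap L" "br00 L" "br01 L" "br10 L" "jac L"
    using assms by (simp add: lie2s_def)
  show "module K (sp0 L)" and "module K (sp1 L)"
    by (fact module_V0 module_V1)+
qed

lemma elas_closed:
  assumes "A \<in> elas K"
  shows "w \<in> carrier (sp1 A) \<Longrightarrow> tmap A w \<in> carrier (sp0 A)"
    and "\<lbrakk>u \<in> carrier (sp0 A); v \<in> carrier (sp0 A)\<rbrakk> \<Longrightarrow> lbr A u v \<in> carrier (sp0 A)"
    and "\<lbrakk>u \<in> carrier (sp0 A); v \<in> carrier (sp0 A)\<rbrakk> \<Longrightarrow> circ A u v \<in> carrier (sp1 A)"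
proof -
  interpret enhanced_leibniz_algebra K "sp0 A" "lbr A" "sp1 A" "tmap A" "circ A"
    using assms by (simp add: elas_def)
  show "w \<in> carrier (sp1 A) \<Longrightarrow> tmap A w \<in> carrier (sp0 A)"
    and "\<lbrakk>u \<in> carrier (sp0 A); v \<in> carrier (sp0 A)\<rbrakk> \<Longrightarrow> lbr A u v \<in> carrier (sp0 A)"
    and "\<lbrakk>u \<in> carrier (sp0 A); v \<in> carrier (sp0 A)\<rbrakk> \<Longrightarrow> circ A u v \<in> carrier (sp1 A)"
    by (fact linear_maps_closed [OF t_linear] bilinear_maps_closed [OF br_bilinear]
        bilinear_maps_closed [OF crc_bilinear])+
qed

lemma lie2s_closed:
  assumes "L \<in> lie2s K"
  shows "w \<in> carrier (sp1 L) \<Longrightarrow> tmap L w \<in> carrier (sp0 L)"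
    and "\<lbrakk>u \<in> carrier (sp0 L); v \<in> carrier (sp0 L)\<rbrakk> \<Longrightarrow> br00 L u v \<in> carrier (sp0 L)"
    and "\<lbrakk>u \<in> carrier (sp0 L); w \<in> carrier (sp1 L)\<rbrakk> \<Longrightarrow> br01 L u w \<in> carrier (sp1 L)"
    and "\<lbrakk>w \<in> carrier (sp1 L); u \<in> carrier (sp0 L)\<rbrakk> \<Longrightarrow> br10 L w u \<in> carrier (sp1 L)"
    and "\<lbrakk>x \<in> carrier (sp0 L); y \<in> carrier (sp0 L); z \<in> carrier (sp0 L)\<rbrakk>
      \<Longrightarrow> jac L x y z \<in> carrier (sp1 L)"
proof -
  interpret lie_2_algebra K "sp0 L" "sp1 L" "tmap L" "br00 L" "br01 L" "br10 L" "jac L"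
    using assms by (simp add: lie2s_def)
  show "w \<in> carrier (sp1 L) \<Longrightarrow> tmap L w \<in> carrier (sp0 L)"
    and "\<lbrakk>u \<in> carrier (sp0 L); v \<in> carrier (sp0 L)\<rbrakk> \<Longrightarrow> br00 L u v \<in> carrier (sp0 L)"
    and "\<lbrakk>u \<in> carrier (sp0 L); w \<in> carrier (sp1 L)\<rbrakk> \<Longrightarrow> br01 L u w \<in> carrier (sp1 L)"
    and "\<lbrakk>w \<in> carrier (sp1 L); u \<in> carrier (sp0 L)\<rbrakk> \<Longrightarrow> br10 L w u \<in> carrier (sp1 L)"
    and "\<lbrakk>x \<in> carrier (sp0 L); y \<in> carrier (sp0 L); z \<in> carrier (sp0 L)\<rbrakk>
      \<Longrightarrow> jac L x y z \<in> carrier (sp1 L)"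
    by (fact linear_maps_closed [OF t_linear] bilinear_maps_closed [OF b00_bilinear]
        bilinear_maps_closed [OF b01_bilinear] bilinear_maps_closed [OF b10_bilinear]
        trilinear_maps_closed [OF l3_trilinear])+
qed

text \<open>Serves both categories. Typing passes from generators to composites by induction. In the
  \<open>hty\<close> component, associativity holds because \<open>map1 h\<close> distributes over
  the sum and addition in the target is associative.\<close>

lemma category_generated:
  fixes K :: "('k, 'm) ring_scheme"
    and Ob :: "('k, 'v, 'w, 'x) two_term_scheme set"
  assumes sp0: "\<And>A. A \<in> Ob \<Longrightarrow> module K (sp0 A)"
    and sp1: "\<And>A. A \<in> Ob \<Longrightarrow> module K (sp1 A)"
    and S: "\<And>f. f \<in> S \<Longrightarrow> src f \<in> Ob \<and> tgt f \<in> Ob \<and> complex_arrow K f"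
    and ids: "\<And>A. A \<in> Ob \<Longrightarrow> id_arrow A \<in> S"
  shows "category \<lparr>Obj = Ob, Arr = generated S, Dom = src, Cod = tgt, Ident = id_arrow, Comp = comp_arrow\<rparr>"
proof -
  have arr: "src f \<in> Ob \<and> tgt f \<in> Ob \<and> complex_arrow K f" if "f \<in> generated S" for f
    using that
  proof induction
    case (generator f)
    then show ?case
      by (rule S)
  next
    case (comp f g)
    then show ?case
      by (simp add: complex_arrow_comp sp0 sp1)
  qed
  have id: "id_arrow A \<in> generated S" if "A \<in> Ob" for A
    using ids [OF that] by (rule generated.generator)
  have id_right: "comp_arrow f (id_arrow (src f)) = f" if f: "f \<in> generated S" for f
  proof -
    note arr [OF f, THEN conjunct2, THEN conjunct2]
    note F = this complex_arrowD [OF this]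
    interpret N: module K "sp1 (tgt f)"
      using arr [OF f] sp1 by simp
    have "complex_arrow K (comp_arrow f (id_arrow (src f)))"
      using arr [OF generated.comp [OF id f]] arr [OF f] by simp
    then show ?thesis
      \<comment> \<open>The composite has \<open>hty\<close> component \<open>map1 f\<close> of zero
        plus \<open>hty f\<close>, hence the appeal to linearity.\<close>
      using arr [OF f] linear_on_group_laws(1) [OF sp1 sp1 F(2)]
      by (intro complex_arrow_eqI [OF _ F(1)])
        (simp_all add: map1_comp_arrow map0_comp_arrow hty_comp_arrow F)
  qed
  have id_left: "comp_arrow (id_arrow (tgt f)) f = f" if f: "f \<in> generated S" for f
  proof -
    note arr [OF f, THEN conjunct2, THEN conjunct2]
    note F = this complex_arrowD [OF this]
    interpret N: module K "sp1 (tgt f)"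
      using arr [OF f] sp1 by simp
    have "complex_arrow K (comp_arrow (id_arrow (tgt f)) f)"
      using arr [OF generated.comp [OF f id]] arr [OF f] by simp
    then show ?thesis
      using linear_onD(1) [OF F(2)] linear_onD(1) [OF F(3)]
      by (intro complex_arrow_eqI [OF _ F(1)])
        (simp_all add: map1_comp_arrow map0_comp_arrow hty_comp_arrow F)
  qed
  have assoc: "comp_arrow h (comp_arrow g f) = comp_arrow (comp_arrow h g) f"
    if f: "f \<in> generated S" and g: "g \<in> generated S" and h: "h \<in> generated S"
      and fg: "tgt f = src g" and gh: "tgt g = src h" for f g h
  proof -
    note arr [OF f, THEN conjunct2, THEN conjunct2]
    note F = complex_arrowD [OF this, unfolded fg]
    note arr [OF g, THEN conjunct2, THEN conjunct2]
    note G = complex_arrowD [OF this, unfolded gh]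
    note arr [OF h, THEN conjunct2, THEN conjunct2]
    note H = complex_arrowD [OF this]
    interpret N: module K "sp1 (tgt h)"
      using arr [OF h] sp1 by simp
    have "complex_arrow K (comp_arrow h (comp_arrow g f))"
      "complex_arrow K (comp_arrow (comp_arrow h g) f)"
      using arr f g h fg gh by (simp_all add: generated.comp)
    then show ?thesis
      using linear_onD [OF F(1)] linear_onD [OF F(2)] linear_onD [OF G(1)] linear_onD [OF G(2)]
        linear_onD [OF H(1)]
      by (intro complex_arrow_eqI [where K = K])
        (simp_all add: map1_comp_arrow map0_comp_arrow hty_comp_arrow fg gh F G H N.M.add.m_assoc)
  qed
  show ?thesis
    by unfold_locales (auto simp: arr id id_right id_left assoc intro: generated.comp)
qed

lemma category_ELeib:
  fixes K :: "('k, 'm) ring_scheme"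
  shows "category (ELeib K :: (('k, 'v, 'w) ela, (('k, 'v, 'w) ela, 'v, 'w) arrow) cat)"
  unfolding ELeib_def
proof (rule category_generated [where K = K])
  show "src f \<in> elas K \<and> tgt f \<in> elas K \<and> complex_arrow K f"
    if "f \<in> ela_plain_arrows K \<union> ela_beta_arrows K" for f :: "(('k, 'v, 'w) ela, 'v, 'w) arrow"
    using that
  proof
    assume "f \<in> ela_plain_arrows K"
    then obtain A B \<phi> \<psi> where "f = plain_arrow A B \<phi> \<psi>" "A \<in> elas K" "B \<in> elas K"
      "\<phi> \<in> linear_maps K (sp1 A) (sp1 B)" "\<psi> \<in> linear_maps K (sp0 A) (sp0 B)"
      unfolding ela_plain_arrows_def by blast
    then show ?thesis
      by (simp add: complex_arrow_plain elas_module) (simp add: plain_arrow_def)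
  next
    assume "f \<in> ela_beta_arrows K"
    then obtain A \<beta> where "f = beta_arrow A (ela_beta A \<beta>) \<beta>" "A \<in> elas K" "ela_beta A \<beta> \<in> elas K"
      "\<beta> \<in> alternating_maps K (sp0 A) (sp1 A)"
      unfolding ela_beta_arrows_def by blast
    moreover have "sp0 (ela_beta A \<beta>) = sp0 A" "sp1 (ela_beta A \<beta>) = sp1 A"
      by (simp_all add: ela_beta_def)
    ultimately show ?thesis
      by (simp add: complex_arrow_beta elas_module) (simp add: beta_arrow_def)
  qed
  \<comment> \<open>\<open>generated\<close> has no clause for identities; they enter as plain
    arrows.\<close>
  show "id_arrow A \<in> ela_plain_arrows K \<union> ela_beta_arrows K" if A: "A \<in> elas K" for A :: "('k, 'v, 'w) ela"
    unfolding ela_plain_arrows_def id_arrow_def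
    using A elas_closed [OF A]
    by (intro UnI1 CollectI)
      (rule exI, rule exI, rule exI, rule exI, rule conjI [OF refl], simp add: identity_linear_maps elas_module)
qed (simp_all add: elas_module)

lemma category_Lie2Alg:
  fixes K :: "('k, 'm) ring_scheme"
  shows "category (Lie2Alg K :: (('k, 'v, 'w) lie2, (('k, 'v, 'w) lie2, 'v, 'w) arrow) cat)"
  unfolding Lie2Alg_def
proof (rule category_generated [where K = K])
  show "src f \<in> lie2s K \<and> tgt f \<in> lie2s K \<and> complex_arrow K f"
    if "f \<in> lie2_plain_arrows K \<union> lie2_beta_arrows K" for f :: "(('k, 'v, 'w) lie2, 'v, 'w) arrow"
    using that
  proof
    assume "f \<in> lie2_plain_arrows K"
    then obtain A B \<phi> \<psi> where "f = plain_arrow A B \<phi> \<psi>" "A \<in> lie2s K" "B \<in> lie2s K"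
      "\<phi> \<in> linear_maps K (sp1 A) (sp1 B)" "\<psi> \<in> linear_maps K (sp0 A) (sp0 B)"
      unfolding lie2_plain_arrows_def by blast
    then show ?thesis
      by (simp add: complex_arrow_plain lie2s_module) (simp add: plain_arrow_def)
  next
    assume "f \<in> lie2_beta_arrows K"
    then obtain A \<beta> where "f = beta_arrow A (lie2_beta A \<beta>) \<beta>" "A \<in> lie2s K" "lie2_beta A \<beta> \<in> lie2s K"
      "\<beta> \<in> alternating_maps K (sp0 A) (sp1 A)"
      unfolding lie2_beta_arrows_def by blast
    moreover have "sp0 (lie2_beta A \<beta>) = sp0 A" "sp1 (lie2_beta A \<beta>) = sp1 A"
      by (simp_all add: lie2_beta_def)
    ultimately show ?thesis
      by (simp add: complex_arrow_beta lie2s_module) (simp add: beta_arrow_def)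
  qed
  show "id_arrow A \<in> lie2_plain_arrows K \<union> lie2_beta_arrows K" if A: "A \<in> lie2s K" for A :: "('k, 'v, 'w) lie2"
    unfolding lie2_plain_arrows_def id_arrow_def
    using A lie2s_closed [OF A]
    by (intro UnI1 CollectI)
      (rule exI, rule exI, rule exI, rule exI, rule conjI [OF refl], simp add: identity_linear_maps lie2s_module)
qed (simp_all add: lie2s_module)

section \<open>The functor\<close>

lemma ela_char_not_2I:
  assumes "A \<in> elas K" and "\<one>\<^bsub>K\<^esub> \<oplus>\<^bsub>K\<^esub> \<one>\<^bsub>K\<^esub> \<noteq> \<zero>\<^bsub>K\<^esub>"
  shows "ela_char_not_2 K (sp0 A) (lbr A) (sp1 A) (tmap A) (circ A)"
  using assms by (simp add: elas_def ela_char_not_2_def ela_char_not_2_axioms_def)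

lemma lie2_of_lie2s:
  assumes "A \<in> elas K" and "\<one>\<^bsub>K\<^esub> \<oplus>\<^bsub>K\<^esub> \<one>\<^bsub>K\<^esub> \<noteq> \<zero>\<^bsub>K\<^esub>"
  shows "lie2_of A \<in> lie2s K"
proof -
  interpret ela_char_not_2 K "sp0 A" "lbr A" "sp1 A" "tmap A" "circ A"
    by (rule ela_char_not_2I [OF assms])
  show ?thesis
    using lie_2_algebra_bracket by (simp add: lie2s_def lie2_of_def bracket_def jacb_def)
qed

lemma ela_beta_elas:
  assumes "A \<in> elas K" and "\<one>\<^bsub>K\<^esub> \<oplus>\<^bsub>K\<^esub> \<one>\<^bsub>K\<^esub> \<noteq> \<zero>\<^bsub>K\<^esub>"
    and "\<beta> \<in> alternating_maps K (sp0 A) (sp1 A)"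
  shows "ela_beta A \<beta> \<in> elas K"
  using ela_char_not_2.enhanced_leibniz_algebra_beta [OF ela_char_not_2I [OF assms(1,2)] assms(3)]
  by (simp add: elas_def ela_beta_def)

text \<open>The assignment on objects intertwines the two kinds of \<beta>-transformation:
  additivity of \<open>t\<close> and \<open>crc\<close> gives the changes of the brackets, and
  \<open>jacb_beta\<close> gives that of the jacobiator.\<close>

lemma lie2_of_ela_beta:
  assumes "A \<in> elas K" and "\<one>\<^bsub>K\<^esub> \<oplus>\<^bsub>K\<^esub> \<one>\<^bsub>K\<^esub> \<noteq> \<zero>\<^bsub>K\<^esub>"
    and \<beta>: "\<beta> \<in> alternating_maps K (sp0 A) (sp1 A)"
  shows "lie2_of (ela_beta A \<beta>) = lie2_beta (lie2_of A) \<beta>"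
proof -
  interpret ela_char_not_2 K "sp0 A" "lbr A" "sp1 A" "tmap A" "circ A"
    by (rule ela_char_not_2I [OF assms(1,2)])
  note lin = alternating_maps_linear_on [OF module_V \<beta>]
  note [simp] = linear_onD(1) [OF lin(1)]
  have b00: "br00 (lie2_of (ela_beta A \<beta>)) = br00 (lie2_beta (lie2_of A) \<beta>)"
    unfolding lie2_of_def ela_beta_def lie2_beta_def
    by (auto intro!: restrict_ext) (rule V_eqI, (rule represents.intros | simp; fail)+)
  have b01: "br01 (lie2_of (ela_beta A \<beta>)) = br01 (lie2_beta (lie2_of A) \<beta>)"
    unfolding lie2_of_def ela_beta_def lie2_beta_def
    by (auto intro!: restrict_ext)
  have b10: "br10 (lie2_of (ela_beta A \<beta>)) = br10 (lie2_beta (lie2_of A) \<beta>)"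
    unfolding lie2_of_def ela_beta_def lie2_beta_def
    by (auto intro!: restrict_ext) (rule W_eqI, (rule represents.intros | simp; fail)+)
  have jac: "jac (lie2_of (ela_beta A \<beta>)) = jac (lie2_beta (lie2_of A) \<beta>)"
    unfolding lie2_of_def ela_beta_def lie2_beta_def Dbar_def
    using jacb_beta [OF \<beta>]
    by (auto intro!: restrict_ext simp: jacb_def bracket_def)
  show ?thesis
    by (rule lie2.equality) (fact b00 b01 b10 jac | simp add: lie2_of_def ela_beta_def lie2_beta_def)+
qed

section \<open>Images of the generating arrows\<close>

text \<open>The brackets and the jacobiator are sums of terms built from \<open>tmap\<close>,
  \<open>lbr\<close> and \<open>circ\<close>, so linear maps compatible with these three preserve
  them.\<close>

lemma lie2_of_plain_arrow:
  assumes f: "f \<in> ela_plain_arrows K" and two: "\<one>\<^bsub>K\<^esub> \<oplus>\<^bsub>K\<^esub> \<one>\<^bsub>K\<^esub> \<noteq> \<zero>\<^bsub>K\<^esub>"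
  shows "lie2_of_arrow f \<in> lie2_plain_arrows K"
proof -
  obtain A B \<phi> \<psi> where f_eq: "f = plain_arrow A B \<phi> \<psi>"
    and A: "A \<in> elas K" and B: "B \<in> elas K"
    and \<phi>: "\<phi> \<in> linear_maps K (sp1 A) (sp1 B)" and \<psi>: "\<psi> \<in> linear_maps K (sp0 A) (sp0 B)"
    and t: "\<And>w. w \<in> carrier (sp1 A) \<Longrightarrow> \<psi> (tmap A w) = tmap B (\<phi> w)"
    and br: "\<And>u v. \<lbrakk>u \<in> carrier (sp0 A); v \<in> carrier (sp0 A)\<rbrakk> \<Longrightarrow> \<psi> (lbr A u v) = lbr B (\<psi> u) (\<psi> v)"
    and crc: "\<And>u v. \<lbrakk>u \<in> carrier (sp0 A); v \<in> carrier (sp0 A)\<rbrakk> \<Longrightarrow> \<phi> (circ A u v) = circ B (\<psi> u) (\<psi> v)"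
    using f by (auto simp: ela_plain_arrows_def)
  interpret A: ela_char_not_2 K "sp0 A" "lbr A" "sp1 A" "tmap A" "circ A"
    by (rule ela_char_not_2I [OF A two])
  interpret B: ela_char_not_2 K "sp0 B" "lbr B" "sp1 B" "tmap B" "circ B"
    by (rule ela_char_not_2I [OF B two])
  note lin = \<phi> [THEN linear_maps_linear_on] \<psi> [THEN linear_maps_linear_on]
  \<comment> \<open>Oriented so that \<open>\<phi>\<close> and \<open>\<psi>\<close> are pushed
    inward to the arguments on both sides of every equation.\<close>
  note [simp] = t br crc
    linear_onD(1,2) [OF lin(1)] linear_on_group_laws [OF A.module_W B.module_W lin(1)]
    linear_onD(1,2) [OF lin(2)] linear_on_group_laws [OF A.module_V B.module_V lin(2)]
  have "lie2_of_arrow f = plain_arrow (lie2_of A) (lie2_of B) \<phi> \<psi>"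
    by (simp add: f_eq lie2_of_arrow_def plain_arrow_def lie2_of_def)
  moreover have "plain_arrow (lie2_of A) (lie2_of B) \<phi> \<psi> \<in> lie2_plain_arrows K"
    unfolding lie2_plain_arrows_def
    using lie2_of_lie2s [OF A two] lie2_of_lie2s [OF B two] \<phi> \<psi>
    by (intro CollectI)
      (rule exI, rule exI, rule exI, rule exI, rule conjI [OF refl], simp add: lie2_of_def)
  ultimately show ?thesis
    by simp
qed

lemma lie2_of_beta_arrow:
  assumes A: "A \<in> elas K" and two: "\<one>\<^bsub>K\<^esub> \<oplus>\<^bsub>K\<^esub> \<one>\<^bsub>K\<^esub> \<noteq> \<zero>\<^bsub>K\<^esub>"
    and \<beta>: "\<beta> \<in> alternating_maps K (sp0 A) (sp1 A)"
  shows "beta_arrow A (ela_beta A \<beta>) \<beta> \<in> ela_beta_arrows K"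
    and "lie2_of_arrow (beta_arrow A (ela_beta A \<beta>) \<beta>)
      = beta_arrow (lie2_of A) (lie2_beta (lie2_of A) \<beta>) \<beta>"
    and "beta_arrow (lie2_of A) (lie2_beta (lie2_of A) \<beta>) \<beta> \<in> lie2_beta_arrows K"
proof -
  show "beta_arrow A (ela_beta A \<beta>) \<beta> \<in> ela_beta_arrows K"
    using ela_beta_elas [OF assms] A \<beta> by (auto simp: ela_beta_arrows_def)
  show "lie2_of_arrow (beta_arrow A (ela_beta A \<beta>) \<beta>)
      = beta_arrow (lie2_of A) (lie2_beta (lie2_of A) \<beta>) \<beta>"
    using lie2_of_ela_beta [OF assms] by (simp add: lie2_of_arrow_def beta_arrow_def) (simp add: lie2_of_def)
  \<comment> \<open>The transformed structure is the image of an enhanced Leibniz algebra, so its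
    axioms come from \<open>lie2_of_lie2s\<close>.\<close>
  have "lie2_beta (lie2_of A) \<beta> \<in> lie2s K"
    using lie2_of_lie2s [OF ela_beta_elas [OF assms] two] by (simp add: lie2_of_ela_beta [OF assms])
  moreover have "\<beta> \<in> alternating_maps K (sp0 (lie2_of A)) (sp1 (lie2_of A))"
    using \<beta> by (simp add: lie2_of_def)
  ultimately show "beta_arrow (lie2_of A) (lie2_beta (lie2_of A) \<beta>) \<beta> \<in> lie2_beta_arrows K"
    using lie2_of_lie2s [OF A two] by (auto simp: lie2_beta_arrows_def)
qed

section \<open>Functoriality\<close>

text \<open>Composition uses only the underlying spaces and the components of the arrows, all of
  which are kept.\<close>

lemma lie2_of_comp_arrow:
  "lie2_of_arrow (comp_arrow g f) = comp_arrow (lie2_of_arrow g) (lie2_of_arrow f)"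
  by (simp add: lie2_of_arrow_def comp_arrow_def lie2_of_def)

lemma lie2_of_generated:
  assumes "f \<in> generated (ela_plain_arrows K \<union> ela_beta_arrows K)"
    and two: "\<one>\<^bsub>K\<^esub> \<oplus>\<^bsub>K\<^esub> \<one>\<^bsub>K\<^esub> \<noteq> \<zero>\<^bsub>K\<^esub>"
  shows "lie2_of_arrow f \<in> generated (lie2_plain_arrows K \<union> lie2_beta_arrows K)"
  using assms(1)
proof induction
  case (generator f)
  then have "lie2_of_arrow f \<in> lie2_plain_arrows K \<union> lie2_beta_arrows K"
    using lie2_of_plain_arrow [OF _ two] lie2_of_beta_arrow(2,3) [OF _ two]
    by (fastforce simp: ela_beta_arrows_def)
  then show ?case
    by (rule generated.generator)
next
  case (comp f g)
  then show ?case
    unfolding lie2_of_comp_arrow by (intro generated.comp) (simp_all add: lie2_of_arrow_def)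
qed

lemma cat_functor_lie2_of:
  assumes two: "\<one>\<^bsub>K\<^esub> \<oplus>\<^bsub>K\<^esub> \<one>\<^bsub>K\<^esub> \<noteq> \<zero>\<^bsub>K\<^esub>"
  shows "cat_functor (ELeib K) (Lie2Alg K) lie2_of lie2_of_arrow"
proof (intro cat_functor.intro category_ELeib category_Lie2Alg cat_functor_axioms.intro)
  show "lie2_of_arrow (Ident (ELeib K) A) = Ident (Lie2Alg K) (lie2_of A)" for A
    by (simp add: ELeib_def Lie2Alg_def lie2_of_arrow_def id_arrow_def plain_arrow_def lie2_of_def)
\<comment> \<open>\<open>lie2_of_arrow\<close> is unfolded only beneath \<open>src\<close> and
  \<open>tgt\<close>, so that elsewhere \<open>lie2_of_generated\<close> and
  \<open>lie2_of_comp_arrow\<close> still match.\<close>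
qed (simp_all add: ELeib_def Lie2Alg_def lie2_of_lie2s lie2_of_generated lie2_of_comp_arrow two
    lie2_of_arrow_def [THEN arg_cong, of src] lie2_of_arrow_def [THEN arg_cong, of tgt])

text \<open>Functoriality alone sends a generator to some composite of generators. The other
  conjuncts add that its type and its \<beta> are kept, and that every alternating \<beta> gives an
  arrow on both sides.\<close>

theorem theorem3p6:
  fixes K :: "('k, 'm) ring_scheme"
  assumes "field K" and "\<one>\<^bsub>K\<^esub> \<oplus>\<^bsub>K\<^esub> \<one>\<^bsub>K\<^esub> \<noteq> \<zero>\<^bsub>K\<^esub>"
  shows "cat_functor
           (ELeib K :: (('k, 'v, 'w) ela, (('k, 'v, 'w) ela, 'v, 'w) arrow) cat)
           (Lie2Alg K :: (('k, 'v, 'w) lie2, (('k, 'v, 'w) lie2, 'v, 'w) arrow) cat)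
           lie2_of lie2_of_arrow
       \<and> (\<forall>f \<in> (ela_plain_arrows K :: (('k, 'v, 'w) ela, 'v, 'w) arrow set).
             lie2_of_arrow f \<in> lie2_plain_arrows K)
       \<and> (\<forall>A \<in> (elas K :: ('k, 'v, 'w) ela set). \<forall>\<beta> \<in> alternating_maps K (sp0 A) (sp1 A).
             beta_arrow A (ela_beta A \<beta>) \<beta> \<in> ela_beta_arrows K \<and>
             lie2_of_arrow (beta_arrow A (ela_beta A \<beta>) \<beta>)
               = beta_arrow (lie2_of A) (lie2_beta (lie2_of A) \<beta>) \<beta> \<and>
             beta_arrow (lie2_of A) (lie2_beta (lie2_of A) \<beta>) \<beta> \<in> lie2_beta_arrows K)"
  using cat_functor_lie2_of [OF assms(2)] lie2_of_plain_arrow [OF _ assms(2)]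
    lie2_of_beta_arrow [OF _ assms(2)]
  by blast

end
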